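(* Let $N=\dim H=1$. The group $G_-$ acts transitively on $GW_0$.
   Context: Here $H=\mathbb C$ with $(x,y)=xy$ (so $g_{1,1}=1$), $\mathbf 1=1$. Variables $t_0,t_1,\dots$; $q_i=t_i-\delta_{i,1}$; $\partial_i=\partial/\partial t_i=\partial/\partial q_i$; functions $F$ are formal power series in the $t_i$. $GW_0$ is the set of all $F$ satisfying (DE) $\sum_{i\ge0}q_i\partial_iF=2F$; (SE) $\sum_{i\ge0}q_{i+1}\partial_iF=-\frac12q_0^2$; (TRR) $\partial_{k+1}\partial_l\partial_mF=\partial_k\partial_0F\cdot\partial_0\partial_l\partial_mF$ for all $k,l,m\ge0$. $G_-$ is the group of series $S(z)=1+\sum_{i>0}S_iz^{-i}$ with $S(-z)S(z)=1$; for $N=1$ it is the abelian group $G_-=\{\exp(\sum_{i\ge1}a_iz^{-2i+1}):a_i\in\mathbb C\}$. The subgroup $\{\exp(az^{-1}):a\in\mathbb C\}$ acts trivially on $GW_0$ (string equation). An element $S=\exp(\sum_{i\ge1}a_{2i+1}z^{-2i-1})$ acts by $$(\widehat SF)(\mathbf q)=F\big([S^{-1}(z)\mathbf q(z)]_+\big)+\frac12\sum_{k,l\ge0}W_{k,l}q_kq_l,\qquad \sum_{k,l\ge0}\frac{W_{k,l}}{z^kw^l}=\frac{S^{-1}(w)S^{-1}(z)-1}{z^{-1}+w^{-1}},$$ where $\mathbf q(z)=\sum_{n\ge0}q_nz^n$, $[\cdot]_+$ is the part with non-negative powers of $z$, and $F(\mathbf q(z))$ means $F(q_0,q_1,\dots)$.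 (Equivalently, the graph of $d(\widehat SF)$ is the image under $S(z)$ of the graph of $dF$ in $\mathbb C((z^{-1}))$ with coordinates $\sum_nq_nz^n+\sum_np_n(-z)^{-n-1}$, $p_n=\partial_nF$.) *)

theory Defs
  imports
    Complex_Main
    "HOL-Library.Multiset"
    "HOL-Library.Groups_Big_Fun"
    "HOL-Computational_Algebra.Formal_Power_Series"
    "HOL-Algebra.Group_Action"
begin

unbundle fps_syntax

section \<open>Formal power series in countably many variables\<close>

text \<open>
  The ring of formal power series over the complex numbers in the variables
  \<open>t\<^sub>0, t\<^sub>1, \<dots>\<close>. The multiset \<open>{#k\<^sub>1, \<dots>, k\<^sub>r#}\<close> stands for the monomial
  \<open>t\<^bsub>k\<^sub>1\<^esub> \<cdots> t\<^bsub>k\<^sub>r\<^esub>\<close>; arbitrary (in particular infinite) families of coefficients are allowed.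
\<close>

typedef mps = "UNIV :: (nat multiset \<Rightarrow> complex) set"
  morphisms mps_coeff Abs_mps
  by simp

lemma mps_coeff_Abs [simp]: "mps_coeff (Abs_mps f) m = f m"
  by (simp add: Abs_mps_inverse)

lemma mps_eqI: "(\<And>m. mps_coeff F m = mps_coeff G m) \<Longrightarrow> F = G"
  by (metis ext mps_coeff_inverse)

lemma finite_mset_splits: "finite {p. fst p + snd p = (m :: 'a multiset)}"
proof (induction m)
  case empty
  have "{p. fst p + snd p = ({#} :: 'a multiset)} \<subseteq> {({#}, {#})}" by auto
  then show ?case by (rule finite_subset) simp
next
  case (add x m)
  let ?S = "{p. fst p + snd p = m}"
  have "{p. fst p + snd p = add_mset x m}
      \<subseteq> (\<lambda>p. (add_mset x (fst p), snd p)) ` ?S \<union> (\<lambda>p. (fst p, add_mset x (snd p))) ` ?S"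
  proof
    fix p assume "p \<in> {p. fst p + snd p = add_mset x m}"
    then have p: "fst p + snd p = add_mset x m" by simp
    then have "x \<in># fst p \<or> x \<in># snd p" by (metis union_iff union_single_eq_member)
    then show "p \<in> (\<lambda>p. (add_mset x (fst p), snd p)) ` ?S \<union> (\<lambda>p. (fst p, add_mset x (snd p))) ` ?S"
    proof
      assume "x \<in># fst p"
      then obtain a where a: "fst p = add_mset x a" by (metis mset_add)
      then have "(a, snd p) \<in> ?S" using p by simp
      then show ?thesis using a by (force intro!: image_eqI[of _ _ "(a, snd p)"] simp: prod_eq_iff)
    next
      assume "x \<in># snd p"
      then obtain b where b: "snd p = add_mset x b" by (metis mset_add)
      then have "(fst p, b) \<in> ?S" using p by simp
      then show ?thesis using b by (force intro!: image_eqI[of _ _ "(fst p, b)"] simp: prod_eq_iff)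
    qed
  qed
  then show ?case using add.IH by (meson finite_UnI finite_imageI finite_subset)
qed

instantiation mps :: comm_ring_1
begin

definition "0 = Abs_mps (\<lambda>m. 0)"
definition "1 = Abs_mps (\<lambda>m. if m = {#} then 1 else 0)"
definition "F + G = Abs_mps (\<lambda>m. mps_coeff F m + mps_coeff G m)"
definition "F - G = Abs_mps (\<lambda>m. mps_coeff F m - mps_coeff G m)"
definition "- F = Abs_mps (\<lambda>m. - mps_coeff F m)"
definition "F * G = Abs_mps (\<lambda>m. \<Sum>p | fst p + snd p = m. mps_coeff F (fst p) * mps_coeff G (snd p))"

instance
proof
  fix F G H :: mps
  show "F * G * H = F * (G * H)"
  proof (rule mps_eqI)
    fix m
    let ?f = "mps_coeff F" and ?g = "mps_coeff G" and ?h = "mps_coeff H"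
    have "mps_coeff (F * G * H) m =
      (\<Sum>p | fst p + snd p = m. \<Sum>q | fst q + snd q = fst p. ?f (fst q) * ?g (snd q) * ?h (snd p))"
      by (simp add: times_mps_def sum_distrib_right)
    also have "\<dots> = (\<Sum>(p, q)\<in>(SIGMA p:{p. fst p + snd p = m}. {q. fst q + snd q = fst p}).
        ?f (fst q) * ?g (snd q) * ?h (snd p))"
      by (rule sum.Sigma) (auto simp: finite_mset_splits)
    also have "\<dots> = (\<Sum>(p, q)\<in>(SIGMA p:{p. fst p + snd p = m}. {q. fst q + snd q = snd p}).
        ?f (fst p) * (?g (fst q) * ?h (snd q)))"
      by (rule sum.reindex_bij_witness
            [where j = "\<lambda>(p, q). ((fst q, snd q + snd p), (snd q, snd p))"
               and i = "\<lambda>(p, q). ((fst p + fst q, snd q), (fst p, fst q))"])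
         (auto simp: add.assoc mult.assoc)
    also have "\<dots> = (\<Sum>p | fst p + snd p = m. \<Sum>q | fst q + snd q = snd p. ?f (fst p) * (?g (fst q) * ?h (snd q)))"
      by (rule sum.Sigma [symmetric]) (auto simp: finite_mset_splits)
    also have "\<dots> = mps_coeff (F * (G * H)) m"
      by (simp add: times_mps_def sum_distrib_left)
    finally show "mps_coeff (F * G * H) m = mps_coeff (F * (G * H)) m" .
  qed
  show "F * G = G * F"
  proof (rule mps_eqI)
    fix m
    show "mps_coeff (F * G) m = mps_coeff (G * F) m"
      unfolding times_mps_def mps_coeff_Abs
      by (rule sum.reindex_bij_witness[where i = prod.swap and j = prod.swap])
         (auto simp: add.commute mult.commute)
  qed
  show "1 * F = F"
  proof (rule mps_eqI)
    fix m
    have "mps_coeff (1 * F) m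
        = (\<Sum>p | fst p + snd p = m. if p = ({#}, m) then mps_coeff F m else 0)"
      unfolding times_mps_def one_mps_def mps_coeff_Abs
      by (rule sum.cong) (auto simp: prod_eq_iff)
    also have "\<dots> = mps_coeff F m"
      by (simp add: sum.delta finite_mset_splits)
    finally show "mps_coeff (1 * F) m = mps_coeff F m" .
  qed
  show "(F + G) * H = F * H + G * H"
    by (rule mps_eqI) (simp add: times_mps_def plus_mps_def algebra_simps sum.distrib)
  show "(0::mps) \<noteq> 1"
  proof
    assume "(0::mps) = 1"
    then have "mps_coeff 0 {#} = mps_coeff 1 {#}" by simp
    then show False by (simp add: zero_mps_def one_mps_def)
  qed
qed (auto intro!: mps_eqI simp: plus_mps_def minus_mps_def uminus_mps_def zero_mps_def)

end

definition mps_const :: "complex \<Rightarrow> mps" where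
  "mps_const c = Abs_mps (\<lambda>m. if m = {#} then c else 0)"

definition mps_var :: "nat \<Rightarrow> mps" where
  "mps_var i = Abs_mps (\<lambda>m. if m = {#i#} then 1 else 0)"

definition mps_deriv :: "nat \<Rightarrow> mps \<Rightarrow> mps" where
  "mps_deriv i F = Abs_mps (\<lambda>m. of_nat (count m i + 1) * mps_coeff F (add_mset i m))"

text \<open>
  Infinite sums of power series are taken coefficientwise and are meant for families in which
  every monomial occurs in only finitely many members (\<^const>\<open>Sum_any\<close> is \<open>0\<close> otherwise).
  This is the case in all uses below.
\<close>

definition mps_sum :: "('i \<Rightarrow> mps) \<Rightarrow> mps" where
  "mps_sum f = Abs_mps (\<lambda>m. Sum_any (\<lambda>i. mps_coeff (f i) m))"

text \<open>Substitution \<open>F(T\<^sub>0, T\<^sub>1, \<dots>)\<close>, the variable \<open>t\<^sub>n\<close> being replaced by the series \<open>T n\<close>.\<close>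

definition mps_subst :: "mps \<Rightarrow> (nat \<Rightarrow> mps) \<Rightarrow> mps" where
  "mps_subst F T = mps_sum (\<lambda>u :: nat multiset. mps_const (mps_coeff F u) * (\<Prod>n\<in>#u. T n))"


section \<open>The set \<open>GW\<^sub>0\<close>\<close>

text \<open>Functions are power series in \<open>t\<close>; the dilaton-shifted coordinates are \<open>q\<^sub>i = t\<^sub>i - \<delta>\<^bsub>i,1\<^esub>\<close>.\<close>

definition dshift :: "nat \<Rightarrow> mps" where
  "dshift i = (if i = 1 then 1 else 0)"

definition qvar :: "nat \<Rightarrow> mps" where
  "qvar i = mps_var i - dshift i"

definition dilaton_eq :: "mps \<Rightarrow> bool" where
  "dilaton_eq F \<longleftrightarrow> mps_sum (\<lambda>i. qvar i * mps_deriv i F) = 2 * F"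

definition string_eq :: "mps \<Rightarrow> bool" where
  "string_eq F \<longleftrightarrow> mps_sum (\<lambda>i. qvar (i + 1) * mps_deriv i F) = - mps_const (1/2) * qvar 0 ^ 2"

definition topological_recursion :: "mps \<Rightarrow> bool" where
  "topological_recursion F \<longleftrightarrow> (\<forall>k l m.
     mps_deriv (k + 1) (mps_deriv l (mps_deriv m F)) =
     mps_deriv k (mps_deriv 0 F) * mps_deriv 0 (mps_deriv l (mps_deriv m F)))"

definition GW0 :: "mps set" where
  "GW0 = {F. dilaton_eq F \<and> string_eq F \<and> topological_recursion F}"


section \<open>The group \<open>G\<^sub>-\<close> and its action\<close>

text \<open>
  A series in \<open>z\<^sup>-\<^sup>1\<close> is represented as a formal power series whose indeterminate is \<open>z\<^sup>-\<^sup>1\<close>.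
\<close>

definition G_minus :: "complex fps monoid" where
  "G_minus = \<lparr>carrier = {S. S $ 0 = 1 \<and> (S oo - fps_X) * S = 1}, monoid.mult = (*), one = 1\<rparr>"

text \<open>
  \<open>W_series s\<close> is \<open>\<Sum> W\<^bsub>k,l\<^esub> z\<^sup>-\<^sup>k w\<^sup>-\<^sup>l = (s(w) s(z) - 1) / (z\<^sup>-\<^sup>1 + w\<^sup>-\<^sup>1)\<close>, where \<open>s\<close> will be \<open>S\<^sup>-\<^sup>1\<close>.
  The outer indeterminate is \<open>z\<^sup>-\<^sup>1\<close> and the inner one \<open>w\<^sup>-\<^sup>1\<close>, so that
  \<open>W\<^bsub>k,l\<^esub> = W_series s $ k $ l\<close>. Bivariate power series have no division operation, hence
  the description; existence and uniqueness are \<open>W_series_ex1\<close> below.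
\<close>

definition W_series :: "complex fps \<Rightarrow> complex fps fps" where
  "W_series s = (THE W. (fps_X + fps_const fps_X) * W
                      = fps_const s * Abs_fps (\<lambda>k. fps_const (s $ k)) - 1)"

text \<open>The coefficient of \<open>z\<^sup>n\<close> in \<open>[s(z) q(z)]\<^sub>+\<close>.\<close>

definition q_plus :: "complex fps \<Rightarrow> nat \<Rightarrow> mps" where
  "q_plus s n = mps_sum (\<lambda>i. mps_const (s $ i) * qvar (n + i))"

text \<open>
  The quantized operator of \<open>S = exp (\<Sum>\<^bsub>i\<ge>1\<^esub> a\<^bsub>2i+1\<^esub> z\<^sup>-\<^sup>2\<^sup>i\<^sup>-\<^sup>1)\<close>. The function \<open>F\<close> is evaluated at the
  point with \<open>q\<close>-coordinates \<open>q_plus (inverse S) n\<close>, hence with \<open>t\<close>-coordinates shifted back by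
  \<open>dshift n\<close>. As \<open>S\<close> has no \<open>z\<^sup>-\<^sup>1\<close> term, these have no constant terms and the substitution
  is well defined (\<open>finite_subst_support\<close> below).
\<close>

definition quant :: "complex fps \<Rightarrow> mps \<Rightarrow> mps" where
  "quant S F = mps_subst F (\<lambda>n. q_plus (inverse S) n + dshift n)
     + mps_const (1/2) *
       mps_sum (\<lambda>(k, l). mps_const (W_series (inverse S) $ k $ l) * qvar k * qvar l)"

text \<open>
  Every element of \<open>G\<^sub>-\<close> is uniquely \<open>exp (a z\<^sup>-\<^sup>1)\<close> times an element without \<open>z\<^sup>-\<^sup>1\<close> term, where
  \<open>a\<close> is its \<open>z\<^sup>-\<^sup>1\<close> coefficient (\<open>G_minus_decomp\<close> below). The first factor acts trivially: on power
  series at \<open>t = 0\<close> its flow \<open>t\<^sub>0 \<mapsto> t\<^sub>0 + a + \<dots>\<close> only makes sense infinitesimally, where by the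
  string equation it fixes every element of \<open>GW\<^sub>0\<close>.
\<close>

definition G_act :: "complex fps \<Rightarrow> mps \<Rightarrow> mps" where
  "G_act S F = quant (fps_exp (- (S $ 1)) * S) F"


subsection \<open>Well-definedness\<close>

lemma G_minus_iff: "S \<in> carrier G_minus \<longleftrightarrow> S $ 0 = 1 \<and> (S oo - fps_X) * S = 1"
  by (simp add: G_minus_def)

lemma G_minus_mult:
  assumes "S \<in> carrier G_minus" "T \<in> carrier G_minus"
  shows "S * T \<in> carrier G_minus"
proof -
  have "(S * T) oo - fps_X = (S oo - fps_X) * (T oo - fps_X)"
    by (rule fps_compose_mult_distrib) simp
  then have "((S * T) oo - fps_X) * (S * T) = ((S oo - fps_X) * S) * ((T oo - fps_X) * T)"
    by (simp only: mult_ac)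
  also have "\<dots> = 1" using assms by (simp only: G_minus_iff mult_1)
  finally show ?thesis using assms by (simp add: G_minus_iff)
qed

lemma fps_exp_in_G_minus: "fps_exp a \<in> carrier G_minus"
proof -
  have "fps_exp a oo - fps_X = (fps_exp (- a) :: complex fps)"
    by (rule fps_ext) (simp add: fps_compose_uminus' power_minus' power_minus[of a])
  then show ?thesis by (simp add: G_minus_iff fps_exp_add_mult [symmetric])
qed

lemma G_minus_decomp:
  assumes "S \<in> carrier G_minus"
  shows "\<exists>!(a, S'). S' \<in> carrier G_minus \<and> S' $ 1 = 0 \<and> S = fps_exp a * S'"
    and "fps_exp (- (S $ 1)) * S \<in> carrier G_minus"
    and "(fps_exp (- (S $ 1)) * S) $ 1 = 0"
proof -
  show 2: "fps_exp (- (S $ 1)) * S \<in> carrier G_minus"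
    using assms fps_exp_in_G_minus by (rule_tac G_minus_mult)
  show 3: "(fps_exp (- (S $ 1)) * S) $ 1 = 0"
    using assms by (simp add: G_minus_iff fps_mult_nth_1)
  have inv: "fps_exp a * (fps_exp (- a) * T) = T" "fps_exp (- a) * (fps_exp a * T) = T"
    for a :: complex and T
  proof -
    have "fps_exp a * fps_exp (- a) = 1"
      by (simp flip: fps_exp_add_mult)
    then show "fps_exp a * (fps_exp (- a) * T) = T" "fps_exp (- a) * (fps_exp a * T) = T"
      by (metis mult.assoc mult.commute mult_1)+
  qed
  show "\<exists>!(a, S'). S' \<in> carrier G_minus \<and> S' $ 1 = 0 \<and> S = fps_exp a * S'"
  proof (rule ex1I[of _ "(S $ 1, fps_exp (- (S $ 1)) * S)"])
    fix p assume "case p of (a, S') \<Rightarrow> S' \<in> carrier G_minus \<and> S' $ 1 = 0 \<and> S = fps_exp a * S'"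
    then obtain a T where p: "p = (a, T)" "T \<in> carrier G_minus" "T $ 1 = 0" "S = fps_exp a * T"
      by (cases p) auto
    then have "S $ 1 = a" by (simp add: G_minus_iff fps_mult_nth_1)
    then show "p = (S $ 1, fps_exp (- (S $ 1)) * S)"
      by (simp only: p inv)
  qed (use 2 3 inv in auto)
qed

lemma G_act_exp: "S \<in> carrier G_minus \<Longrightarrow> G_act (fps_exp a * S) F = G_act S F"
  by (simp add: G_act_def G_minus_iff fps_mult_nth_1 mult.assoc [symmetric]
        fps_exp_add_mult [symmetric])

lemma G_act_eq_quant: "S $ 1 = 0 \<Longrightarrow> G_act S F = quant S F"
  by (simp add: G_act_def)

lemma G_minus_inverse:
  assumes "S \<in> carrier G_minus"
  shows "inverse S \<in> carrier G_minus"
proof -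
  have S0: "S $ 0 = 1" and S: "(S oo - fps_X) * S = 1" using assms by (auto simp: G_minus_iff)
  have eq: "inverse S = S oo - fps_X"
    using S S0 by (metis fps_inverse_unique mult.commute)
  have "(S oo - fps_X) oo - fps_X = S"
    by (rule fps_ext) (simp add: fps_compose_uminus' power_mult_distrib [symmetric] mult.assoc [symmetric])
  then show ?thesis using S S0 by (simp add: eq G_minus_iff mult.commute)
qed

lemma W_series_ex1:
  assumes "s \<in> carrier G_minus"
  shows "\<exists>!W. (fps_X + fps_const fps_X) * W
            = fps_const s * Abs_fps (\<lambda>k. fps_const (s $ k)) - 1"
proof -
  have s0: "s $ 0 = 1" and s: "(s oo - fps_X) * s = 1" using assms by (auto simp: G_minus_iff)
  define w where "w k l = (\<Sum>j\<le>l. (-1) ^ j * s $ (k + 1 + j) * s $ (l - j))" for k l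
  define W where "W = Abs_fps (\<lambda>k. Abs_fps (w k))"
  have step: "w k (Suc l) = s $ (k + 1) * s $ Suc l - w (Suc k) l" for k l
    unfolding w_def by (simp add: sum.atMost_Suc_shift sum_negf del: sum.atMost_Suc)
  have zero: "w 0 l = s $ Suc l" for l
  proof -
    have "0 = ((s oo - fps_X) * s) $ Suc l" by (simp add: s)
    also have "\<dots> = (\<Sum>j\<le>Suc l. (-1) ^ j * s $ j * s $ (Suc l - j))"
      by (simp add: fps_mult_nth fps_compose_uminus' atLeast0AtMost)
    also have "\<dots> = s $ Suc l - w 0 l"
      unfolding w_def by (simp add: sum.atMost_Suc_shift sum_negf s0 del: sum.atMost_Suc)
    finally show ?thesis by simp
  qed
  have w0: "w k 0 = s $ Suc k" for k by (simp add: w_def s0)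
  have W: "(fps_X + fps_const fps_X) * W = fps_const s * Abs_fps (\<lambda>k. fps_const (s $ k)) - 1"
  proof (intro fps_ext)
    fix k l
    show "((fps_X + fps_const fps_X) * W) $ k $ l
        = (fps_const s * Abs_fps (\<lambda>k. fps_const (s $ k)) - 1) $ k $ l"
      by (cases k; cases l) (auto simp: W_def distrib_right s0 w0 zero step)
  qed
  have nz: "fps_X + fps_const fps_X \<noteq> (0 :: complex fps fps)"
  proof
    assume "fps_X + fps_const fps_X = (0 :: complex fps fps)"
    then have "(fps_X + fps_const fps_X :: complex fps fps) $ 1 $ 0 = 0" by simp
    then show False by simp
  qed
  show ?thesis
  proof (rule ex1I[of _ W], rule W)
    fix V assume "(fps_X + fps_const fps_X) * V
        = fps_const s * Abs_fps (\<lambda>k. fps_const (s $ k)) - 1"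
    with W nz show "V = W" by (metis mult_left_cancel)
  qed
qed

lemma mps_coeff_const_mult: "mps_coeff (mps_const c * F) m = c * mps_coeff F m"
proof -
  have "mps_coeff (mps_const c * F) m
      = (\<Sum>p | fst p + snd p = m. if p = ({#}, m) then c * mps_coeff F m else 0)"
    unfolding times_mps_def mps_const_def mps_coeff_Abs
    by (rule sum.cong) (auto simp: prod_eq_iff)
  then show ?thesis by (simp add: sum.delta finite_mset_splits)
qed

lemma coeff_q_plus_nonzero:
  assumes "s $ 0 = 1" "s $ 1 = 0" "mps_coeff (q_plus s n + dshift n) m \<noteq> 0"
  shows "\<exists>j\<ge>n. m = {#j#}"
proof (rule ccontr)
  assume no: "\<not> (\<exists>j\<ge>n. m = {#j#})"
  have c: "mps_coeff (mps_const (s $ i) * qvar (n + i)) m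
      = (if m = {#} \<and> n = 1 \<and> i = 0 then - 1 else 0)" for i
    using no assms(1,2)
    by (cases "n + i = 1"; cases n; cases i)
       (auto simp: mps_coeff_const_mult qvar_def dshift_def mps_var_def minus_mps_def
          one_mps_def zero_mps_def)
  have "mps_coeff (q_plus s n) m = (if m = {#} \<and> n = 1 then - 1 else 0)"
    unfolding q_plus_def mps_sum_def mps_coeff_Abs c
    by (auto simp: Sum_any.expand_superset[of "{0}"])
  then have "mps_coeff (q_plus s n + dshift n) m = 0"
    by (auto simp: plus_mps_def dshift_def one_mps_def zero_mps_def)
  then show False using assms(3) by simp
qed

lemma finite_subst_support:
  assumes "s $ 0 = 1" "s $ 1 = 0"
  shows "finite {u. mps_coeff (mps_const (mps_coeff F u) *
            (\<Prod>n\<in>#u. q_plus s n + dshift n)) m \<noteq> 0}"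
proof -
  let ?T = "\<lambda>n. q_plus s n + dshift n"
  have *: "size u = size m \<and> (\<forall>n\<in>#u. \<exists>j\<in>#m. n \<le> j)"
    if "mps_coeff (\<Prod>n\<in>#u. ?T n) m \<noteq> 0" for u m
    using that
  proof (induction u arbitrary: m)
    case empty
    then show ?case by (auto simp: one_mps_def split: if_splits)
  next
    case (add n u)
    have "mps_coeff (?T n * (\<Prod>n\<in>#u. ?T n)) m \<noteq> 0" using add.prems by simp
    then obtain p where p: "fst p + snd p = m" "mps_coeff (?T n) (fst p) \<noteq> 0"
      "mps_coeff (\<Prod>n\<in>#u. ?T n) (snd p) \<noteq> 0"
      unfolding times_mps_def mps_coeff_Abs by (auto elim!: sum.not_neutral_contains_not_neutral)
    obtain j where j: "j \<ge> n" "fst p = {#j#}"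
      using coeff_q_plus_nonzero[OF assms p(2)] by blast
    show ?case using add.IH[OF p(3)] j p(1) by auto
  qed
  have "{u. mps_coeff (mps_const (mps_coeff F u) * (\<Prod>n\<in>#u. ?T n)) m \<noteq> 0}
      \<subseteq> mset ` {xs. set xs \<subseteq> {.. Max (set_mset m)} \<and> length xs = size m}"
  proof
    fix u assume "u \<in> {u. mps_coeff (mps_const (mps_coeff F u) * (\<Prod>n\<in>#u. ?T n)) m \<noteq> 0}"
    then have u: "size u = size m" "\<forall>n\<in>#u. \<exists>j\<in>#m. n \<le> j"
      using *[of u m] by (auto simp: mps_coeff_const_mult)
    obtain xs where xs: "mset xs = u" using ex_mset by blast
    have "set xs \<subseteq> {.. Max (set_mset m)}"
      using u(2) xs by (force intro: order_trans[OF _ Max_ge])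
    then show "u \<in> mset ` {xs. set xs \<subseteq> {.. Max (set_mset m)} \<and> length xs = size m}"
      using u(1) xs by (metis (mono_tags, lifting) image_eqI mem_Collect_eq size_mset)
  qed
  then show ?thesis
    by (rule finite_subset) (intro finite_imageI finite_lists_length_eq finite_atMost)
qed

end

theory Submission
  imports Defs
begin

text \<open>
  For \<open>c \<in> G\<^sub>-\<close> without \<open>z\<^sup>-\<^sup>1\<close> term and a function \<open>u\<close> with \<open>u(0) = 0\<close> put \<open>b(z) = c(z) e\<^bsup>u/z\<^esup>\<close>, and let
  \<open>w\<^bsub>kl\<^esub>\<close> be the coefficients of \<open>(b(z) b(w) - 1) / (z\<^sup>-\<^sup>1 + w\<^sup>-\<^sup>1)\<close>. Every \<open>F \<in> GW\<^sub>0\<close> has the form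
  \<open>F = (\<Sum> q\<^sub>k q\<^sub>l w\<^bsub>kl\<^esub>) / 2\<close> where \<open>u = \<partial>\<^sub>0\<^sup>2 F\<close> solves \<open>\<Sum> q\<^sub>k b\<^sub>k = 0\<close>: by (TRR) all second derivatives of \<open>F\<close>
  are functions of \<open>u\<close>, the string equation identifies them with \<open>w\<^bsub>kl\<^esub>\<close>, and the dilaton equation
  recovers \<open>F\<close> from them. Conversely every such \<open>F\<close> lies in \<open>GW\<^sub>0\<close>, and \<open>c\<close> determines \<open>u\<close>, hence \<open>F\<close>.
  The quantized operator of \<open>S\<close> replaces \<open>c\<close> by \<open>c S\<^sup>-\<^sup>1\<close>, so the action on \<open>GW\<^sub>0\<close> becomes
  multiplication in an abelian group, which is transitive.
\<close>

section \<open>Calculus of power series in countably many variables\<close>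

lemma mps_coeff_simps [simp]:
  "mps_coeff 0 m = 0"
  "mps_coeff 1 m = (if m = {#} then 1 else 0)"
  "mps_coeff (F + G) m = mps_coeff F m + mps_coeff G m"
  "mps_coeff (F - G) m = mps_coeff F m - mps_coeff G m"
  "mps_coeff (- F) m = - mps_coeff F m"
  "mps_coeff (mps_const a) m = (if m = {#} then a else 0)"
  "mps_coeff (mps_const a * F) m = a * mps_coeff F m"
  by (simp_all add: zero_mps_def one_mps_def plus_mps_def minus_mps_def uminus_mps_def
      mps_const_def mps_coeff_const_mult [unfolded mps_const_def])

lemma mps_coeff_mult:
  "mps_coeff (F * G) m = (\<Sum>p | fst p + snd p = m. mps_coeff F (fst p) * mps_coeff G (snd p))"
  by (simp add: times_mps_def)

lemma mps_coeff_sum [simp]: "mps_coeff (sum f A) m = (\<Sum>i\<in>A. mps_coeff (f i) m)"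
  by (induction A rule: infinite_finite_induct) auto

lemma mps_coeff_mult_empty [simp]: "mps_coeff (F * G) {#} = mps_coeff F {#} * mps_coeff G {#}"
proof -
  have "{p. fst p + snd p = ({#} :: nat multiset)} = {({#}, {#})}" by auto
  then show ?thesis by (simp add: mps_coeff_mult)
qed

lemma mps_coeff_power_empty [simp]: "mps_coeff (F ^ n) {#} = mps_coeff F {#} ^ n"
  by (induction n) auto

lemma mps_const_simps:
  "mps_const 0 = 0" "mps_const 1 = 1"
  "mps_const (a + b) = mps_const a + mps_const b"
  "mps_const (a * b) = mps_const a * mps_const b"
  "mps_const (- a) = - mps_const a"
  by (auto intro!: mps_eqI)

lemma mps_const_sum: "mps_const (sum f A) = (\<Sum>i\<in>A. mps_const (f i))"
  by (induction A rule: infinite_finite_induct) (auto simp: mps_const_simps)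

lemma mps_const_power: "mps_const (a ^ n) = mps_const a ^ n"
  by (induction n) (auto simp: mps_const_simps)

lemma mps_const_of_nat: "mps_const (of_nat n) = of_nat n"
  by (induction n) (auto simp: mps_const_simps)

lemma mps_coeff_qvar:
  "mps_coeff (qvar i) m = (if m = {#i#} then 1 else 0) - (if i = 1 \<and> m = {#} then 1 else 0)"
  by (simp add: qvar_def dshift_def mps_var_def)


lemma mps_coeff_deriv [simp]:
  "mps_coeff (mps_deriv i F) m = of_nat (count m i + 1) * mps_coeff F (add_mset i m)"
  by (simp add: mps_deriv_def)

lemma mps_deriv_linear [simp]:
  "mps_deriv i 0 = 0"
  "mps_deriv i (mps_const a) = 0"
  "mps_deriv i (F + G) = mps_deriv i F + mps_deriv i G"
  "mps_deriv i (F - G) = mps_deriv i F - mps_deriv i G"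
  "mps_deriv i (- F) = - mps_deriv i F"
  "mps_deriv i (mps_const a * F) = mps_const a * mps_deriv i F"
  "mps_deriv i 1 = 0"
  by (auto intro!: mps_eqI simp: distrib_left right_diff_distrib mult.left_commute simp del: of_nat_Suc)

lemma mps_deriv_sum [simp]: "mps_deriv i (sum f A) = (\<Sum>j\<in>A. mps_deriv i (f j))"
  by (induction A rule: infinite_finite_induct) auto

lemma mps_deriv_commute: "mps_deriv i (mps_deriv j F) = mps_deriv j (mps_deriv i F)"
  by (rule mps_eqI) (auto simp: add_mset_commute)

lemma mps_deriv_qvar [simp]: "mps_deriv i (qvar j) = (if i = j then 1 else 0)"
  by (rule mps_eqI) (auto simp: mps_coeff_qvar)

text \<open>Half of the product rule in coefficients: splits without \<open>i\<close> in the first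
  part have weight 0, and from all others one copy of \<open>i\<close> is removed.\<close>

lemma sum_count_splits:
  fixes F G :: "nat multiset \<Rightarrow> complex"
  shows "(\<Sum>p | fst p + snd p = add_mset i m. of_nat (count (fst p) i) * F (fst p) * G (snd p))
    = (\<Sum>p | fst p + snd p = m. of_nat (count (fst p) i + 1) * F (add_mset i (fst p)) * G (snd p))"
proof -
  have "(\<Sum>p | fst p + snd p = add_mset i m. of_nat (count (fst p) i) * F (fst p) * G (snd p))
    = (\<Sum>p | fst p + snd p = add_mset i m \<and> i \<in># fst p. of_nat (count (fst p) i) * F (fst p) * G (snd p))"
    by (rule sum.mono_neutral_right) (auto simp: finite_mset_splits not_in_iff)
  also have "\<dots> = (\<Sum>p | fst p + snd p = m. of_nat (count (fst p) i + 1) * F (add_mset i (fst p)) * G (snd p))"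
    by (rule sum.reindex_bij_witness
      [where j = "\<lambda>p. (fst p - {#i#}, snd p)" and i = "\<lambda>p. (add_mset i (fst p), snd p)"])
      (auto simp del: of_nat_Suc)
  finally show ?thesis .
qed

lemma mps_deriv_mult [simp]:
  "mps_deriv i (F * G) = mps_deriv i F * G + F * mps_deriv i G"
proof (rule mps_eqI)
  fix m
  let ?f = "mps_coeff F" and ?g = "mps_coeff G"
  have "mps_coeff (mps_deriv i (F * G)) m
      = (\<Sum>p | fst p + snd p = add_mset i m. of_nat (count (add_mset i m) i) * ?f (fst p) * ?g (snd p))"
    unfolding mps_coeff_deriv mps_coeff_mult sum_distrib_left
    by (simp only: mult.assoc count_add_mset if_True simp_thms Suc_eq_plus1)
  also have "\<dots> = (\<Sum>p | fst p + snd p = add_mset i m. of_nat (count (fst p) i) * ?f (fst p) * ?g (snd p))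
      + (\<Sum>p | fst p + snd p = add_mset i m. of_nat (count (snd p) i) * ?g (snd p) * ?f (fst p))"
    unfolding sum.distrib [symmetric]
  proof (intro sum.cong refl)
    fix p assume "p \<in> {p. fst p + snd p = add_mset i m}"
    then have "add_mset i m = fst p + snd p" by simp
    then show "of_nat (count (add_mset i m) i) * ?f (fst p) * ?g (snd p)
      = of_nat (count (fst p) i) * ?f (fst p) * ?g (snd p) + of_nat (count (snd p) i) * ?g (snd p) * ?f (fst p)"
      by (simp only: count_union of_nat_add distrib_left distrib_right mult_ac)
  qed
  also have "(\<Sum>p | fst p + snd p = add_mset i m. of_nat (count (snd p) i) * ?g (snd p) * ?f (fst p))
     = (\<Sum>p | fst p + snd p = add_mset i m. of_nat (count (fst p) i) * ?g (fst p) * ?f (snd p))"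
    by (rule sum.reindex_bij_witness [where i = prod.swap and j = prod.swap])
      (auto simp: add.commute)
  also have "\<dots> = mps_coeff (mps_deriv i G * F) m"
    by (simp only: sum_count_splits mps_coeff_mult mps_coeff_deriv)
  also have "(\<Sum>p | fst p + snd p = add_mset i m. of_nat (count (fst p) i) * ?f (fst p) * ?g (snd p))
     = mps_coeff (mps_deriv i F * G) m"
    by (simp only: sum_count_splits mps_coeff_mult mps_coeff_deriv)
  finally show "mps_coeff (mps_deriv i (F * G)) m
      = mps_coeff (mps_deriv i F * G + F * mps_deriv i G) m"
    by (simp add: mult.commute)
qed

lemma mps_deriv_power_Suc:
  "mps_deriv i (F ^ Suc n) = of_nat (Suc n) * F ^ n * mps_deriv i F"
  by (induction n) (simp_all add: algebra_simps)

text \<open>In characteristic 0, a coefficient at a nonempty monomial is a coefficient of a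
  derivative divided by a positive integer.\<close>

lemma mps_eqI_deriv:
  assumes "\<And>i. mps_deriv i F = mps_deriv i G" "mps_coeff F {#} = mps_coeff G {#}"
  shows "F = G"
proof (rule mps_eqI)
  fix m
  show "mps_coeff F m = mps_coeff G m"
  proof (cases m)
    case empty
    then show ?thesis using assms(2) by simp
  next
    case (add i m')
    have "mps_coeff (mps_deriv i F) m' = mps_coeff (mps_deriv i G) m'" using assms(1) by simp
    then show ?thesis using add by (simp del: of_nat_Suc)
  qed
qed

text \<open>The factor \<open>1 - y\<close> is invertible. By induction on degree: each term of the
  coefficient at \<open>m\<close> contains the constant term of \<open>y\<close> or a coefficient of
  \<open>d\<close> of smaller degree.\<close>

lemma mps_eq_0_if_mult_small:
  assumes "d = d * y" "mps_coeff y {#} = 0"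
  shows "d = 0"
proof (rule mps_eqI)
  fix m
  show "mps_coeff d m = mps_coeff 0 m"
  proof (induction m rule: measure_induct_rule [of size])
    case (less m)
    have "mps_coeff d m = mps_coeff (d * y) m" using assms(1) by simp
    also have "\<dots> = 0"
      unfolding mps_coeff_mult
    proof (intro sum.neutral ballI)
      fix p assume p: "p \<in> {p. fst p + snd p = m}"
      show "mps_coeff d (fst p) * mps_coeff y (snd p) = 0"
      proof (cases "snd p = {#}")
        case False
        then have "size (fst p) < size m" using p by (auto simp: nonempty_has_size)
        then show ?thesis using less by simp
      qed (simp add: assms(2))
    qed
    finally show ?case by simp
  qed
qed

section \<open>Truncation to finitely many variables\<close>

text \<open>
  Setting \<open>t\<^sub>n = 0\<close> for \<open>n > N\<close> is a ring homomorphism that makes sums \<open>\<Sum> q\<^sub>i X\<^sub>i\<close> finite, and a series is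
  determined by these truncations. All infinite sums below are handled in this way.
\<close>

definition mps_trunc :: "nat \<Rightarrow> mps \<Rightarrow> mps" where
  "mps_trunc N F = Abs_mps (\<lambda>m. if set_mset m \<subseteq> {..N} then mps_coeff F m else 0)"

lemma mps_coeff_trunc:
  "mps_coeff (mps_trunc N F) m = (if set_mset m \<subseteq> {..N} then mps_coeff F m else 0)"
  by (simp add: mps_trunc_def)

lemma mps_trunc_linear [simp]:
  "mps_trunc N 0 = 0"
  "mps_trunc N 1 = 1"
  "mps_trunc N (mps_const a) = mps_const a"
  "mps_trunc N (F + G) = mps_trunc N F + mps_trunc N G"
  "mps_trunc N (F - G) = mps_trunc N F - mps_trunc N G"
  "mps_trunc N (- F) = - mps_trunc N F"
  "mps_trunc N (mps_trunc N F) = mps_trunc N F"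
  by (auto intro!: mps_eqI simp: mps_coeff_trunc)

lemma mps_trunc_mult [simp]: "mps_trunc N (F * G) = mps_trunc N F * mps_trunc N G"
proof (rule mps_eqI)
  fix m
  show "mps_coeff (mps_trunc N (F * G)) m = mps_coeff (mps_trunc N F * mps_trunc N G) m"
  proof (cases "set_mset m \<subseteq> {..N}")
    case True
    then have "set_mset (fst p) \<subseteq> {..N} \<and> set_mset (snd p) \<subseteq> {..N}"
      if "fst p + snd p = m" for p using that by auto
    with True show ?thesis by (simp add: mps_coeff_trunc mps_coeff_mult)
  next
    case False
    then have "\<not> set_mset (fst p) \<subseteq> {..N} \<or> \<not> set_mset (snd p) \<subseteq> {..N}"
      if "fst p + snd p = m" for p using that by auto
    then have "(\<Sum>p | fst p + snd p = m. mps_coeff (mps_trunc N F) (fst p) * mps_coeff (mps_trunc N G) (snd p)) = 0"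
      by (intro sum.neutral) (auto simp: mps_coeff_trunc)
    with False show ?thesis by (simp add: mps_coeff_trunc [of _ "_ * _"] mps_coeff_mult)
  qed
qed

lemma mps_trunc_sum [simp]: "mps_trunc N (sum f A) = (\<Sum>i\<in>A. mps_trunc N (f i))"
  by (induction A rule: infinite_finite_induct) auto

text \<open>The bound matters: for \<open>i > N\<close> the right side is 0, whereas the left side
  need not be.\<close>

lemma mps_trunc_deriv: "i \<le> N \<Longrightarrow> mps_trunc N (mps_deriv i F) = mps_deriv i (mps_trunc N F)"
  by (auto intro!: mps_eqI simp: mps_coeff_trunc)

lemma mps_eqI_trunc:
  assumes "\<And>N. N \<ge> N0 \<Longrightarrow> mps_trunc N F = mps_trunc N G"
  shows "F = G"
proof (rule mps_eqI)
  fix m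
  define N where "N = Max (insert N0 (set_mset m))"
  have "N0 \<le> N" "set_mset m \<subseteq> {..N}" by (auto simp: N_def)
  then show "mps_coeff F m = mps_coeff G m"
    using arg_cong [OF assms, of N "\<lambda>F. mps_coeff F m"] by (simp add: mps_coeff_trunc)
qed

lemma mps_trunc_infsum:
  assumes "finite A" "\<And>i. i \<notin> A \<Longrightarrow> mps_trunc N (f i) = 0"
  shows "mps_trunc N (mps_sum f) = (\<Sum>i\<in>A. mps_trunc N (f i))"
proof (rule mps_eqI)
  fix m
  show "mps_coeff (mps_trunc N (mps_sum f)) m = mps_coeff (\<Sum>i\<in>A. mps_trunc N (f i)) m"
  proof (cases "set_mset m \<subseteq> {..N}")
    case True
    have "mps_coeff (f i) m = 0" if "i \<notin> A" for i
      using arg_cong [OF assms(2) [OF that], of "\<lambda>F. mps_coeff F m"] True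
      by (simp add: mps_coeff_trunc)
    then have "Sum_any (\<lambda>i. mps_coeff (f i) m) = (\<Sum>i\<in>A. mps_coeff (f i) m)"
      using assms(1) by (intro Sum_any.expand_superset) auto
    with True show ?thesis by (simp add: mps_coeff_trunc mps_sum_def)
  qed (simp add: mps_coeff_trunc)
qed

text \<open>With \<open>N >= 1\<close> the index \<open>i\<close> is at least 2; this excludes
  \<open>q_1\<close>, whose constant term -1 would survive truncation at
  \<open>N = 0\<close>.\<close>

lemma mps_trunc_qvar_eq_0: "N \<ge> 1 \<Longrightarrow> i > N \<Longrightarrow> mps_trunc N (qvar i) = 0"
  by (rule mps_eqI) (auto simp: mps_coeff_trunc mps_coeff_qvar)

lemma mps_trunc_infsum_qvar:
  assumes "N \<ge> 1"
  shows "mps_trunc N (mps_sum (\<lambda>i. qvar i * X i)) = mps_trunc N (\<Sum>i\<le>N. qvar i * X i)"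
  using assms by (subst mps_trunc_infsum [of "{..N}"]) (auto simp: mps_trunc_qvar_eq_0)

lemma mps_trunc_infsum_qvar_Suc:
  assumes "N \<ge> 1"
  shows "mps_trunc N (mps_sum (\<lambda>i. qvar (i + 1) * X i)) = mps_trunc N (\<Sum>i<N. qvar (Suc i) * X i)"
  using assms by (subst mps_trunc_infsum [of "{..<N}"]) (auto simp: mps_trunc_qvar_eq_0)


section \<open>The matrix of a symplectic series\<close>

definition fps_neg :: "'a :: comm_ring_1 fps \<Rightarrow> 'a fps" where
  "fps_neg S = Abs_fps (\<lambda>n. (- 1) ^ n * S $ n)"

lemma fps_neg_nth [simp]: "fps_neg S $ n = (- 1) ^ n * S $ n"
  by (simp add: fps_neg_def)

lemma fps_neg_mult: "fps_neg (S * T) = fps_neg S * fps_neg T"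
proof (rule fps_ext)
  fix n
  have "(- 1) ^ n * (S $ i * T $ (n - i)) = (- 1) ^ i * S $ i * ((- 1) ^ (n - i) * T $ (n - i))"
    if "i \<le> n" for i
  proof -
    have "(- 1 :: 'a) ^ n = (- 1) ^ i * (- 1) ^ (n - i)"
      using that by (simp flip: power_add)
    then show ?thesis by (simp add: mult_ac)
  qed
  then show "fps_neg (S * T) $ n = (fps_neg S * fps_neg T) $ n"
    by (simp add: fps_mult_nth sum_distrib_left)
qed

lemma G_minus_iff_fps_neg: "S \<in> carrier G_minus \<longleftrightarrow> S $ 0 = 1 \<and> fps_neg S * S = 1"
proof -
  have "S oo - fps_X = fps_neg S" by (rule fps_ext) (simp add: fps_compose_uminus')
  then show ?thesis by (simp add: G_minus_iff)
qed

text \<open>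
  The coefficients of \<open>(S(z) S(w) - 1) / (z\<^sup>-\<^sup>1 + w\<^sup>-\<^sup>1)\<close> over any commutative ring; the quotient is a power
  series only if \<open>S(-z) S(z) = 1\<close>.
\<close>

definition W_coeff :: "'a :: comm_ring_1 fps \<Rightarrow> nat \<Rightarrow> nat \<Rightarrow> 'a" where
  "W_coeff S k l = (\<Sum>j\<le>l. (- 1) ^ j * S $ (k + 1 + j) * S $ (l - j))"

text \<open>The quotient multiplied by \<open>z^(-1) + w^(-1)\<close>, read off at
  \<open>z^(-k-1) w^(-l-1)\<close>.\<close>

lemma W_coeff_Suc: "W_coeff S k (Suc l) = S $ Suc k * S $ Suc l - W_coeff S (Suc k) l"
  unfolding W_coeff_def by (simp add: sum.atMost_Suc_shift sum_negf del: sum.atMost_Suc)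

lemma W_coeff_0: "S $ 0 = 1 \<Longrightarrow> W_coeff S k 0 = S $ Suc k"
  by (simp add: W_coeff_def)

text \<open>The recursion lowers \<open>l\<close> at the cost of raising \<open>k\<close>, so column
  0 fixes all entries. This identifies the matrices met below.\<close>

lemma W_coeff_unique:
  assumes "S $ 0 = 1" "\<And>k. g k 0 = S $ Suc k"
    "\<And>k l. g k (Suc l) + g (Suc k) l = S $ Suc k * S $ Suc l"
  shows "g k l = W_coeff S k l"
proof (induction l arbitrary: k)
  case 0
  then show ?case by (simp add: assms W_coeff_0)
next
  case (Suc l)
  then show ?case using assms(3) [of k l] by (simp add: W_coeff_Suc eq_diff_eq)
qed

lemma fps_neg_mult_nth_Suc:
  assumes "S $ 0 = 1"
  shows "(fps_neg S * S) $ Suc l = S $ Suc l - W_coeff S 0 l"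
  using assms
  by (simp add: fps_mult_nth W_coeff_def atLeast0AtMost sum.atMost_Suc_shift sum_negf
      del: sum.atMost_Suc)

text \<open>In terms of the matrix, the symplectic condition says that row 0 agrees with column 0,
  the latter being the coefficients of \<open>S\<close>.\<close>

lemma fps_neg_mult_eq_1_iff:
  assumes "S $ 0 = 1"
  shows "fps_neg S * S = 1 \<longleftrightarrow> (\<forall>l. W_coeff S 0 l = S $ Suc l)"
proof
  assume "fps_neg S * S = 1"
  then show "\<forall>l. W_coeff S 0 l = S $ Suc l"
    using fps_neg_mult_nth_Suc [OF assms] by simp
next
  assume *: "\<forall>l. W_coeff S 0 l = S $ Suc l"
  show "fps_neg S * S = 1"
  proof (rule fps_ext)
    fix n show "(fps_neg S * S) $ n = 1 $ n"
      using fps_neg_mult_nth_Suc [OF assms] * assms by (cases n) auto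
  qed
qed

text \<open>The right side of the recursion is symmetric, so symmetry propagates from row and column
  0 to all entries.\<close>

lemma W_coeff_commute:
  assumes "S $ 0 = 1" "fps_neg S * S = 1"
  shows "W_coeff S k l = W_coeff S l k"
proof (induction l arbitrary: k)
  case 0
  then show ?case using assms by (simp add: W_coeff_0 fps_neg_mult_eq_1_iff)
next
  case (Suc l)
  then show ?case using W_coeff_Suc [of S l k] by (simp add: W_coeff_Suc mult.commute)
qed

lemma W_series_nth:
  assumes "s \<in> carrier G_minus"
  shows "W_series s $ k $ l = W_coeff s k l"
proof (rule W_coeff_unique)
  have W: "(fps_X + fps_const fps_X) * W_series s
      = fps_const s * Abs_fps (\<lambda>k. fps_const (s $ k)) - 1"
    unfolding W_series_def by (rule theI' [OF W_series_ex1 [OF assms]])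
  show s0: "s $ 0 = 1" using assms by (simp add: G_minus_iff)
  \<comment> \<open>At \<open>z^(-k-1) w^0\<close> the summand \<open>w^(-1)\<close> contributes
    nothing.\<close>
  show "W_series s $ k $ 0 = s $ Suc k" for k
    using arg_cong [OF W, of "\<lambda>W. W $ Suc k $ 0"] s0 by (simp add: distrib_right)
  show "W_series s $ k $ Suc l + W_series s $ Suc k $ l = s $ Suc k * s $ Suc l" for k l
    using arg_cong [OF W, of "\<lambda>W. W $ Suc k $ Suc l"]
    by (simp add: distrib_right mult.commute [of "s $ Suc l"])
qed

lemma fps_mult_nth_Suc_rev:
  fixes s S :: "'a :: comm_ring_1 fps"
  shows "S $ 0 = 1 \<Longrightarrow> (S * s) $ Suc n = s $ Suc n + (\<Sum>i\<le>n. s $ (n - i) * S $ Suc i)"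
  by (simp add: fps_mult_nth atLeast0AtMost sum.atMost_Suc_shift mult.commute del: sum.atMost_Suc)

text \<open>Division of \<open>S(z)S(w)s(z)s(w) - 1 = s(z)s(w)(S(z)S(w) - 1) + (s(z)s(w) -
  1)\<close> by \<open>z^(-1) + w^(-1)\<close>, verified through the recursion.\<close>

lemma W_coeff_mult:
  fixes s S :: "'a :: comm_ring_1 fps"
  assumes S: "S $ 0 = 1" "fps_neg S * S = 1" and s: "s $ 0 = 1" "fps_neg s * s = 1"
  shows "W_coeff (S * s) n m
    = (\<Sum>i\<le>n. \<Sum>j\<le>m. s $ (n - i) * s $ (m - j) * W_coeff S i j) + W_coeff s n m"
proof (rule W_coeff_unique [symmetric])
  show "(S * s) $ 0 = 1" using S s by simp
  let ?g = "\<lambda>n m. (\<Sum>i\<le>n. \<Sum>j\<le>m. s $ (n - i) * s $ (m - j) * W_coeff S i j) + W_coeff s n m"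
  show "?g k 0 = (S * s) $ Suc k" for k
    using s S by (simp add: W_coeff_0 fps_mult_nth_Suc_rev)
  show "?g n (Suc m) + ?g (Suc n) m = (S * s) $ Suc n * (S * s) $ Suc m" for n m
  proof -
    have W0: "W_coeff S 0 l = S $ Suc l" for l using S by (simp add: fps_neg_mult_eq_1_iff)
    \<comment> \<open>\<open>A n\<close> is the coefficient of \<open>S * s\<close> at
      \<open>Suc n\<close> without its term \<open>s $ Suc n\<close>.\<close>
    define A where "A n = (\<Sum>i\<le>n. s $ (n - i) * S $ Suc i)" for n
    have 1: "(\<Sum>i\<le>n. \<Sum>j\<le>Suc m. s $ (n - i) * s $ (Suc m - j) * W_coeff S i j)
      = s $ Suc m * A n + (\<Sum>i\<le>n. \<Sum>j\<le>m. s $ (n - i) * s $ (m - j) * W_coeff S i (Suc j))"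
      by (simp add: sum.atMost_Suc_shift sum.distrib W_coeff_0 S A_def sum_distrib_left mult_ac
          del: sum.atMost_Suc)
    have 2: "(\<Sum>i\<le>Suc n. \<Sum>j\<le>m. s $ (Suc n - i) * s $ (m - j) * W_coeff S i j)
      = s $ Suc n * A m + (\<Sum>i\<le>n. \<Sum>j\<le>m. s $ (n - i) * s $ (m - j) * W_coeff S (Suc i) j)"
      by (simp add: sum.atMost_Suc_shift W0 A_def sum_distrib_left mult_ac
          del: sum.atMost_Suc)
    \<comment> \<open>By \<open>W_coeff_Suc\<close> the shifted entries add up to
      \<open>S $ Suc i * S $ Suc j\<close>, so the double sum factors.\<close>
    have 3: "(\<Sum>i\<le>n. \<Sum>j\<le>m. s $ (n - i) * s $ (m - j) * W_coeff S i (Suc j))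
      + (\<Sum>i\<le>n. \<Sum>j\<le>m. s $ (n - i) * s $ (m - j) * W_coeff S (Suc i) j) = A n * A m"
      unfolding A_def sum_product sum.distrib [symmetric]
      by (intro sum.cong refl) (simp add: W_coeff_Suc algebra_simps)
    have 4: "W_coeff s n (Suc m) + W_coeff s (Suc n) m = s $ Suc n * s $ Suc m"
      by (simp add: W_coeff_Suc)
    have "?g n (Suc m) + ?g (Suc n) m
      = s $ Suc m * A n + s $ Suc n * A m + A n * A m + s $ Suc n * s $ Suc m"
      unfolding 1 2 3 [symmetric] 4 [symmetric] by (simp add: algebra_simps)
    also have "\<dots> = (S * s) $ Suc n * (S * s) $ Suc m"
      using S by (simp add: fps_mult_nth_Suc_rev A_def algebra_simps)
    finally show ?thesis .
  qed
qed


section \<open>Scalar series and exponentials with coefficients in \<open>mps\<close>\<close>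

text \<open>
  The indeterminate of the outer series being \<open>z\<^sup>-\<^sup>1\<close>, the following are \<open>c(z)\<close>, \<open>e\<^bsup>u/z\<^esup>\<close> and \<open>c(z) e\<^bsup>u/z\<^esup>\<close>.
\<close>

definition fps_lift :: "complex fps \<Rightarrow> mps fps" where
  "fps_lift c = Abs_fps (\<lambda>n. mps_const (c $ n))"

definition fps_expm :: "mps \<Rightarrow> mps fps" where
  "fps_expm u = Abs_fps (\<lambda>n. mps_const (1 / fact n) * u ^ n)"

definition bser :: "complex fps \<Rightarrow> mps \<Rightarrow> mps fps" where
  "bser c u = fps_lift c * fps_expm u"

lemma fps_lift_nth [simp]: "fps_lift c $ n = mps_const (c $ n)"
  by (simp add: fps_lift_def)

lemma fps_expm_nth [simp]: "fps_expm u $ n = mps_const (1 / fact n) * u ^ n"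
  by (simp add: fps_expm_def)

lemma fps_lift_mult: "fps_lift (c * d) = fps_lift c * fps_lift d"
  by (rule fps_ext) (simp add: fps_mult_nth mps_const_sum mps_const_simps)

lemma fps_lift_1 [simp]: "fps_lift 1 = 1"
  by (rule fps_ext) (simp add: mps_const_simps)

lemma fps_neg_lift: "fps_neg (fps_lift c) = fps_lift (fps_neg c)"
  by (rule fps_ext) (simp add: mps_const_simps mps_const_power)

text \<open>The coefficient at \<open>n\<close> is a scalar times \<open>u ^ n\<close>; what remains
  is the scalar identity \<open>e^(-x) e^x = 1\<close>.\<close>

lemma fps_neg_expm: "fps_neg (fps_expm u) * fps_expm u = 1"
proof (rule fps_ext)
  fix n
  have "(fps_neg (fps_expm u) * fps_expm u) $ n
    = (\<Sum>i=0..n. mps_const ((- 1) ^ i * (1 / fact i) * (1 / fact (n - i))) * u ^ n)"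
    unfolding fps_mult_nth
  proof (intro sum.cong refl)
    fix i assume i: "i \<in> {0..n}"
    then have "u ^ n = u ^ i * u ^ (n - i)" by (simp flip: power_add)
    then show "fps_neg (fps_expm u) $ i * fps_expm u $ (n - i)
      = mps_const ((- 1) ^ i * (1 / fact i) * (1 / fact (n - i))) * u ^ n"
      by (simp only: fps_neg_nth fps_expm_nth mps_const_simps mps_const_power mult_ac)
  qed
  also have "\<dots> = mps_const ((fps_exp (- 1) * fps_exp 1 :: complex fps) $ n) * u ^ n"
    by (simp add: fps_mult_nth mps_const_sum sum_distrib_right)
  also have "(fps_exp (- 1) * fps_exp 1 :: complex fps) = 1"
    by (simp flip: fps_exp_add_mult)
  finally show "(fps_neg (fps_expm u) * fps_expm u) $ n = 1 $ n"
    by (simp add: mps_const_simps)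
qed

lemma bser_mult: "bser (c * s) u = bser c u * fps_lift s"
  by (simp add: bser_def fps_lift_mult mult_ac)

lemma bser_nth_0: "c $ 0 = 1 \<Longrightarrow> bser c u $ 0 = 1"
  by (simp add: bser_def mps_const_simps)

lemma bser_nth_1: "c $ 0 = 1 \<Longrightarrow> c $ 1 = 0 \<Longrightarrow> bser c u $ Suc 0 = u"
  by (simp add: bser_def mps_const_simps fps_mult_nth)

lemma fps_neg_fps_lift_G_minus: "c \<in> carrier G_minus \<Longrightarrow> fps_neg (fps_lift c) * fps_lift c = 1"
  by (simp add: fps_neg_lift G_minus_iff_fps_neg flip: fps_lift_mult)

lemma fps_neg_bser:
  assumes "c \<in> carrier G_minus"
  shows "fps_neg (bser c u) * bser c u = 1"
proof -
  have "fps_neg (bser c u) * bser c u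
    = (fps_neg (fps_lift c) * fps_lift c) * (fps_neg (fps_expm u) * fps_expm u)"
    by (simp only: bser_def fps_neg_mult mult_ac)
  also have "\<dots> = 1"
    using assms by (simp only: fps_neg_fps_lift_G_minus fps_neg_expm mult_1)
  finally show ?thesis .
qed

lemma bser_nth: "bser c u $ n = (\<Sum>j\<le>n. mps_const (c $ (n - j) / fact j) * u ^ j)"
  unfolding bser_def fps_mult_nth
  by (rule sum.reindex_bij_witness [where i = "\<lambda>j. n - j" and j = "\<lambda>j. n - j"])
    (auto simp: mult.assoc [symmetric] simp flip: mps_const_simps)

lemma mps_coeff_bser_empty: "mps_coeff u {#} = 0 \<Longrightarrow> mps_coeff (bser c u $ n) {#} = c $ n"
  by (simp add: bser_nth sum.atMost_shift)

text \<open>Differentiating \<open>e^(u/z)\<close> in \<open>u\<close> multiplies it by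
  \<open>z^(-1)\<close>, which shifts coefficients by one place.\<close>

lemma mps_deriv_bser_Suc: "mps_deriv i (bser c u $ Suc n) = bser c u $ n * mps_deriv i u"
proof -
  have "mps_const (c $ (n - j) / fact (Suc j)) * (of_nat (Suc j) * u ^ j * mps_deriv i u)
      = mps_const (c $ (n - j) / fact j) * u ^ j * mps_deriv i u" for j
    unfolding mult.assoc [symmetric] mps_const_of_nat [symmetric] mps_const_simps [symmetric]
    by (simp del: of_nat_Suc)
  then show ?thesis
    unfolding bser_nth sum.atMost_Suc_shift
    by (simp add: mps_deriv_power_Suc sum_distrib_right del: power_Suc of_nat_Suc mps_deriv_mult)
qed

text \<open>The derivative of \<open>b(z) b(w)\<close> in \<open>u\<close> is
  \<open>(z^(-1) + w^(-1)) b(z) b(w)\<close>, and the first factor cancels the denominator.\<close>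

lemma mps_deriv_W_coeff_bser:
  assumes "c $ 0 = 1"
  shows "mps_deriv i (W_coeff (bser c u) k l) = bser c u $ k * bser c u $ l * mps_deriv i u"
proof (induction l arbitrary: k)
  case 0
  then show ?case using assms by (simp add: W_coeff_0 bser_nth_0 mps_deriv_bser_Suc)
next
  case (Suc l)
  then show ?case by (simp add: W_coeff_Suc mps_deriv_bser_Suc algebra_simps)
qed

text \<open>The coefficients of \<open>bser c u\<close> are polynomials in \<open>u\<close>. This
  supplies the common factor \<open>d\<close> in the uniqueness proof.\<close>

lemma dvd_bser_diff: "u - v dvd bser c u $ n - bser c v $ n"
proof -
  have "u - v dvd u ^ j - v ^ j" for j
    by (cases j) (auto simp: power_diff_sumr2 simp del: power_Suc)
  then show ?thesis
    unfolding bser_nth sum_subtractf [symmetric] right_diff_distrib [symmetric]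
    by (intro dvd_sum dvd_mult)
qed


section \<open>Linear substitutions\<close>

text \<open>A triangular change of variables: degree is preserved and indices never rise when
  passing from a monomial of the result to those it comes from. Hence each coefficient of the result
  depends on finitely many of the input.\<close>

definition linear_subst :: "(nat \<Rightarrow> mps) \<Rightarrow> bool" where
  "linear_subst T \<longleftrightarrow> (\<forall>n m. mps_coeff (T n) m \<noteq> 0 \<longrightarrow> (\<exists>j\<ge>n. m = {#j#}))"

text \<open>A finite index set closed under submultisets, so that one range of summation serves a
  monomial and all its factors.\<close>

definition bounded_msets :: "nat \<Rightarrow> nat \<Rightarrow> nat multiset set" where
  "bounded_msets D N = {u. size u \<le> D \<and> set_mset u \<subseteq> {..N}}"

lemma finite_bounded_msets [simp]: "finite (bounded_msets D N)"
proof -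
  have "bounded_msets D N \<subseteq> mset ` {xs. set xs \<subseteq> {..N} \<and> length xs \<le> D}"
  proof
    fix u assume u: "u \<in> bounded_msets D N"
    obtain xs where xs: "mset xs = u" using ex_mset by blast
    then have "xs \<in> {xs. set xs \<subseteq> {..N} \<and> length xs \<le> D}"
      using u by (auto simp: bounded_msets_def)
    then show "u \<in> mset ` {xs. set xs \<subseteq> {..N} \<and> length xs \<le> D}" using xs by blast
  qed
  then show ?thesis by (rule finite_subset) (simp add: finite_lists_length_le)
qed

lemma linear_subst_prod_coeff:
  assumes "linear_subst T" "mps_coeff (\<Prod>n\<in>#u. T n) m \<noteq> 0"
  shows "size u = size m \<and> (\<forall>n\<in>#u. \<exists>j\<in>#m. n \<le> j)"
  using assms(2)
proof (induction u arbitrary: m)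
  case empty
  then show ?case by (simp split: if_splits)
next
  case (add n u)
  have "mps_coeff (T n * (\<Prod>n\<in>#u. T n)) m \<noteq> 0" using add.prems by simp
  then obtain p where p: "fst p + snd p = m" "mps_coeff (T n) (fst p) \<noteq> 0"
    "mps_coeff (\<Prod>n\<in>#u. T n) (snd p) \<noteq> 0"
    unfolding mps_coeff_mult by (auto elim!: sum.not_neutral_contains_not_neutral)
  obtain j where "j \<ge> n" "fst p = {#j#}"
    using assms(1) p(2) unfolding linear_subst_def by blast
  with add.IH [OF p(3)] p(1) show ?case by auto
qed

lemma linear_subst_bounded:
  assumes "linear_subst T" "mps_coeff (\<Prod>n\<in>#u. T n) m \<noteq> 0" "m \<in> bounded_msets D N"
  shows "u \<in> bounded_msets D N"
proof -
  have m: "size m \<le> D" "\<And>j. j \<in># m \<Longrightarrow> j \<le> N"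
    using assms(3) by (auto simp: bounded_msets_def)
  then have "n \<le> N" if "n \<in># u" for n
    using linear_subst_prod_coeff [OF assms(1,2)] that order_trans by blast
  then show ?thesis
    using linear_subst_prod_coeff [OF assms(1,2)] m(1) by (auto simp: bounded_msets_def)
qed

lemma mps_coeff_subst:
  assumes "linear_subst T" "m \<in> bounded_msets D N"
  shows "mps_coeff (mps_subst F T) m
    = (\<Sum>u\<in>bounded_msets D N. mps_coeff F u * mps_coeff (\<Prod>n\<in>#u. T n) m)"
  unfolding mps_subst_def mps_sum_def mps_coeff_Abs mps_coeff_simps
  using linear_subst_bounded [OF assms(1) _ assms(2)]
  by (intro Sum_any.expand_superset) auto

lemma mem_bounded_msets: "\<exists>D N. m \<in> bounded_msets D N"
proof -
  have "m \<in> bounded_msets (size m) (Max (set_mset m))" by (auto simp: bounded_msets_def)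
  then show ?thesis by blast
qed

lemma mps_subst_linear [simp]:
  assumes "linear_subst T"
  shows "mps_subst (F + G) T = mps_subst F T + mps_subst G T"
    "mps_subst (F - G) T = mps_subst F T - mps_subst G T"
    "mps_subst (mps_const a * F) T = mps_const a * mps_subst F T"
proof (rule_tac [!] mps_eqI)
    fix m
    obtain D N where "m \<in> bounded_msets D N" using mem_bounded_msets by blast
    note [simp] = mps_coeff_subst [OF assms this]
    show "mps_coeff (mps_subst (F + G) T) m = mps_coeff (mps_subst F T + mps_subst G T) m"
      "mps_coeff (mps_subst (F - G) T) m = mps_coeff (mps_subst F T - mps_subst G T) m"
      "mps_coeff (mps_subst (mps_const a * F) T) m = mps_coeff (mps_const a * mps_subst F T) m"
      by (simp_all add: distrib_right left_diff_distrib sum.distrib sum_subtractf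
          sum_distrib_left mult.assoc)
qed

lemma mps_subst_monomial:
  "mps_subst (Abs_mps (\<lambda>m. if m = u then a else 0)) T = mps_const a * (\<Prod>n\<in>#u. T n)"
proof (rule mps_eqI)
  fix m
  have e: "(\<lambda>v. (if v = u then a else 0) * mps_coeff (\<Prod>n\<in>#v. T n) m)
    = (\<lambda>v. if v = u then a * mps_coeff (\<Prod>n\<in>#u. T n) m else 0)"
    by auto
  show "mps_coeff (mps_subst (Abs_mps (\<lambda>m. if m = u then a else 0)) T) m
    = mps_coeff (mps_const a * (\<Prod>n\<in>#u. T n)) m"
    unfolding mps_subst_def mps_sum_def mps_coeff_Abs mps_coeff_simps e by simp
qed

lemma mps_subst_const [simp]: "mps_subst (mps_const a) T = mps_const a"
  using mps_subst_monomial [of "{#}" a T] by (simp add: mps_const_def)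

lemma mps_subst_0 [simp]: "mps_subst 0 T = 0"
  using mps_subst_const [of 0 T] by (simp add: mps_const_simps)

lemma mps_subst_1 [simp]: "mps_subst 1 T = 1"
  using mps_subst_const [of 1 T] by (simp add: mps_const_simps)

lemma mps_subst_uminus [simp]: "linear_subst T \<Longrightarrow> mps_subst (- F) T = - mps_subst F T"
  using mps_subst_linear(2) [of T 0 F] by simp

lemma mps_subst_var [simp]: "mps_subst (mps_var i) T = T i"
  using mps_subst_monomial [of "{#i#}" 1 T] by (simp add: mps_var_def mps_const_simps)

lemma mps_subst_qvar: "linear_subst T \<Longrightarrow> mps_subst (qvar i) T = T i - dshift i"
  by (simp add: qvar_def dshift_def)

text \<open>Both sides expand to the same sum over monomials \<open>u\<close> of \<open>F\<close>
  and \<open>v\<close> of \<open>G\<close>; confining both to one finite set justifies the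
  rearrangements.\<close>

lemma mps_subst_mult [simp]:
  assumes T: "linear_subst T"
  shows "mps_subst (F * G) T = mps_subst F T * mps_subst G T"
proof (rule mps_eqI)
  fix m
  obtain D N where m: "m \<in> bounded_msets D N" using mem_bounded_msets by blast
  let ?B = "bounded_msets D N" and ?f = "mps_coeff F" and ?g = "mps_coeff G"
    and ?P = "\<lambda>u. \<Prod>n\<in>#u. T n"
  let ?h = "\<lambda>p. ?f (fst p) * ?g (snd p) * mps_coeff (?P (fst p) * ?P (snd p)) m"
  have B: "fst p \<in> ?B \<and> snd p \<in> ?B" if "fst p + snd p \<in> ?B" for p
    using that by (auto simp: bounded_msets_def)
  have "mps_coeff (mps_subst (F * G) T) m = (\<Sum>u\<in>?B. \<Sum>p | fst p + snd p = u. ?h p)"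
    unfolding mps_coeff_subst [OF T m] mps_coeff_mult [of F G] sum_distrib_right
    by (intro sum.cong refl) auto
  also have "\<dots> = (\<Sum>(u, p)\<in>(SIGMA u:?B. {p. fst p + snd p = u}). ?h p)"
    by (rule sum.Sigma) (auto simp: finite_mset_splits)
  also have "\<dots> = (\<Sum>p | fst p + snd p \<in> ?B. ?h p)"
    by (rule sum.reindex_bij_witness [where j = snd and i = "\<lambda>p. (fst p + snd p, p)"]) auto
  \<comment> \<open>Pairs whose product lies outside the finite set may be added, since the image of
    that product has coefficient 0 at \<open>m\<close>.\<close>
  also have "\<dots> = (\<Sum>p\<in>?B \<times> ?B. ?h p)"
  proof (rule sum.mono_neutral_left)
    show "\<forall>p\<in>?B \<times> ?B - {p. fst p + snd p \<in> ?B}. ?h p = 0"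
    proof
      fix p assume "p \<in> ?B \<times> ?B - {p. fst p + snd p \<in> ?B}"
      then have "mps_coeff (?P (fst p + snd p)) m = 0"
        using linear_subst_bounded [OF T _ m] by blast
      then show "?h p = 0" by simp
    qed
    show "{p. fst p + snd p \<in> ?B} \<subseteq> ?B \<times> ?B"
    proof
      fix p assume "p \<in> {p. fst p + snd p \<in> ?B}"
      then have "fst p \<in> ?B \<and> snd p \<in> ?B" by (intro B) simp
      then show "p \<in> ?B \<times> ?B" by (simp add: mem_Times_iff)
    qed
  qed simp
  also have "\<dots> = (\<Sum>u\<in>?B. \<Sum>v\<in>?B. ?h (u, v))"
    unfolding sum.cartesian_product by (intro sum.cong refl) auto
  also have "\<dots> = (\<Sum>u\<in>?B. \<Sum>v\<in>?B. \<Sum>q | fst q + snd q = m.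
      (?f u * mps_coeff (?P u) (fst q)) * (?g v * mps_coeff (?P v) (snd q)))"
    unfolding mps_coeff_mult sum_distrib_left fst_conv snd_conv by (simp only: mult_ac)
  also have "\<dots> = (\<Sum>q | fst q + snd q = m. \<Sum>u\<in>?B. \<Sum>v\<in>?B.
      (?f u * mps_coeff (?P u) (fst q)) * (?g v * mps_coeff (?P v) (snd q)))"
    by (simp only: sum.swap [of _ "{q. fst q + snd q = m}"])
  also have "\<dots> = mps_coeff (mps_subst F T * mps_subst G T) m"
    unfolding mps_coeff_mult [of "mps_subst F T"]
  proof (intro sum.cong refl)
    fix q assume "q \<in> {q. fst q + snd q = m}"
    then have q: "fst q \<in> ?B \<and> snd q \<in> ?B" using m by (intro B) simp
    show "(\<Sum>u\<in>?B. \<Sum>v\<in>?B.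
        (?f u * mps_coeff (?P u) (fst q)) * (?g v * mps_coeff (?P v) (snd q)))
      = mps_coeff (mps_subst F T) (fst q) * mps_coeff (mps_subst G T) (snd q)"
      unfolding mps_coeff_subst [OF T conjunct1 [OF q]] mps_coeff_subst [OF T conjunct2 [OF q]]
        sum_product ..
  qed
  finally show "mps_coeff (mps_subst (F * G) T) m = mps_coeff (mps_subst F T * mps_subst G T) m" .
qed

lemma mps_subst_power [simp]: "linear_subst T \<Longrightarrow> mps_subst (F ^ n) T = mps_subst F T ^ n"
  by (induction n) auto

lemma mps_subst_sum [simp]:
  "linear_subst T \<Longrightarrow> mps_subst (sum f A) T = (\<Sum>i\<in>A. mps_subst (f i) T)"
  by (induction A rule: infinite_finite_induct) auto

lemma mps_coeff_subst_empty [simp]: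
  assumes "linear_subst T"
  shows "mps_coeff (mps_subst F T) {#} = mps_coeff F {#}"
proof -
  have "{#} \<in> bounded_msets 0 0" "bounded_msets 0 0 = {{#}}" by (auto simp: bounded_msets_def)
  then show ?thesis using mps_coeff_subst [OF assms, of "{#}" 0 0 F] by simp
qed

text \<open>As \<open>T n\<close> involves only \<open>t_j\<close> with \<open>j >= n\<close>,
  variables beyond \<open>N\<close> cannot contribute to monomials in
  \<open>t_0, ..., t_N\<close>.\<close>

lemma mps_trunc_subst:
  assumes "linear_subst T"
  shows "mps_trunc N (mps_subst (mps_trunc N F) T) = mps_trunc N (mps_subst F T)"
proof (rule mps_eqI)
  fix m
  show "mps_coeff (mps_trunc N (mps_subst (mps_trunc N F) T)) m
    = mps_coeff (mps_trunc N (mps_subst F T)) m"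
  proof (cases "set_mset m \<subseteq> {..N}")
    case True
    then have "m \<in> bounded_msets (size m) N" by (simp add: bounded_msets_def)
    note coeff_subst = mps_coeff_subst [OF assms this]
    have "mps_coeff (mps_trunc N F) u = mps_coeff F u" if "u \<in> bounded_msets (size m) N" for u
      using that by (simp add: mps_coeff_trunc bounded_msets_def)
    then show ?thesis
      using True by (simp add: mps_coeff_trunc [of N "mps_subst _ _"] coeff_subst)
  qed (simp add: mps_coeff_trunc)
qed

lemma linear_subst_q_plus:
  "s $ 0 = 1 \<Longrightarrow> s $ 1 = 0 \<Longrightarrow> linear_subst (\<lambda>n. q_plus s n + dshift n)"
  unfolding linear_subst_def using coeff_q_plus_nonzero by blast

lemma mps_trunc_q_plus:
  assumes "N \<ge> 1" "k \<le> N"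
  shows "mps_trunc N (q_plus s k) = mps_trunc N (\<Sum>n=k..N. mps_const (s $ (n - k)) * qvar n)"
proof -
  have "mps_trunc N (q_plus s k) = (\<Sum>i\<le>N - k. mps_trunc N (mps_const (s $ i) * qvar (k + i)))"
    unfolding q_plus_def using assms by (intro mps_trunc_infsum) (auto simp: mps_trunc_qvar_eq_0)
  also have "\<dots> = mps_trunc N (\<Sum>n=k..N. mps_const (s $ (n - k)) * qvar n)"
    unfolding mps_trunc_sum
    by (rule sum.reindex_bij_witness [where i = "\<lambda>n. n - k" and j = "\<lambda>i. k + i"])
      (use assms in auto)
  finally show ?thesis .
qed

lemma mps_subst_bser [simp]:
  "linear_subst T \<Longrightarrow> mps_subst (bser c u $ n) T = bser c (mps_subst u T) $ n"
  by (simp add: bser_nth)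

lemma mps_subst_W_coeff_bser [simp]:
  assumes T: "linear_subst T"
  shows "mps_subst (W_coeff (bser c u) k l) T = W_coeff (bser c (mps_subst u T)) k l"
  using T by (simp add: W_coeff_def)


section \<open>Potentials attached to elements of the group\<close>

text \<open>The equation for \<open>u\<close> and the formula for \<open>F\<close> are infinite
  sums; both are encoded by their truncations, which are finite. At \<open>N = 0\<close> the sums
  would miss the constant term of \<open>q_1\<close>.\<close>

definition gw_rep :: "complex fps \<Rightarrow> mps \<Rightarrow> mps \<Rightarrow> bool" where
  "gw_rep c u F \<longleftrightarrow> c \<in> carrier G_minus \<and> c $ 1 = 0 \<and> mps_coeff u {#} = 0 \<and>
     (\<forall>N\<ge>1. mps_trunc N (\<Sum>k\<le>N. qvar k * bser c u $ k) = 0) \<and>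
     (\<forall>N\<ge>1. mps_trunc N F = mps_trunc N (mps_const (1/2) *
        (\<Sum>k\<le>N. \<Sum>l\<le>N. qvar k * qvar l * W_coeff (bser c u) k l)))"

lemma gw_repD:
  assumes "gw_rep c u F"
  shows "c \<in> carrier G_minus" "c $ 0 = 1" "c $ 1 = 0" "mps_coeff u {#} = 0"
    "N \<ge> 1 \<Longrightarrow> mps_trunc N (\<Sum>k\<le>N. qvar k * bser c u $ k) = 0"
    "N \<ge> 1 \<Longrightarrow> mps_trunc N F = mps_trunc N (mps_const (1/2) *
        (\<Sum>k\<le>N. \<Sum>l\<le>N. qvar k * qvar l * W_coeff (bser c u) k l))"
  using assms unfolding gw_rep_def G_minus_iff by blast+

lemma mps_half_add: "mps_const (1/2) * F + mps_const (1/2) * F = F"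
proof -
  have "mps_const (1/2) + mps_const (1/2) = mps_const (1/2 + 1/2)" by (simp only: mps_const_simps)
  also have "\<dots> = 1" by (simp add: mps_const_simps)
  finally have "mps_const (1/2) + mps_const (1/2) = 1" .
  then show ?thesis by (metis distrib_right mult_1)
qed

lemma mps_half: "mps_const (1/2) * (F + F) = F"
  by (simp only: distrib_left mps_half_add)

lemma sum_atMost_Suc_0_split:
  fixes f :: "nat \<Rightarrow> 'a :: comm_monoid_add"
  assumes "N \<ge> 1"
  shows "(\<Sum>k\<le>N. f k) = f 0 + (f 1 + (\<Sum>k=2..N. f k))"
proof -
  have "{..N} = insert 0 (insert 1 {2..N})" using assms by auto
  then show ?thesis by simp
qed

text \<open>The difference \<open>d\<close> of two solutions satisfies \<open>d = d y\<close> where \<open>y\<close> has no constant term.\<close>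

lemma bser_equation_unique:
  assumes c: "c $ 0 = 1" "c $ 1 = 0"
    and u: "\<And>N. N \<ge> 1 \<Longrightarrow> mps_trunc N (\<Sum>k\<le>N. qvar k * bser c u $ k) = 0"
    and v: "\<And>N. N \<ge> 1 \<Longrightarrow> mps_trunc N (\<Sum>k\<le>N. qvar k * bser c v $ k) = 0"
  shows "u = v"
proof (rule mps_eqI_trunc [of 1])
  fix N :: nat assume N: "N \<ge> 1"
  define d where "d = u - v"
  have "\<forall>k. \<exists>e. bser c u $ k - bser c v $ k = d * e"
    unfolding d_def using dvd_bser_diff dvdE by metis
  then obtain e where e: "\<And>k. bser c u $ k - bser c v $ k = d * e k" by metis
  \<comment> \<open>The terms \<open>k = 0\<close> cancel because \<open>b_0 = 1\<close>, and
    \<open>b_1 = u\<close> turns the terms \<open>k = 1\<close> into \<open>(t_1 - 1) d\<close>.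
    Moving \<open>-d\<close> across leaves \<open>d = d y\<close>.\<close>
  define y where "y = mps_var 1 + (\<Sum>k=2..N. qvar k * e k)"
  have "0 = mps_trunc N ((\<Sum>k\<le>N. qvar k * bser c u $ k) - (\<Sum>k\<le>N. qvar k * bser c v $ k))"
    using u [OF N] v [OF N] by (simp only: mps_trunc_linear diff_self)
  also have "(\<Sum>k\<le>N. qvar k * bser c u $ k) - (\<Sum>k\<le>N. qvar k * bser c v $ k)
    = (\<Sum>k\<le>N. qvar k * (bser c u $ k - bser c v $ k))"
    by (simp add: right_diff_distrib sum_subtractf)
  also have "\<dots> = qvar 1 * d + (\<Sum>k=2..N. qvar k * (d * e k))"
    unfolding sum_atMost_Suc_0_split [OF N] using c
    by (simp only: bser_nth_0 bser_nth_1 One_nat_def e d_def [symmetric]) simp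
  also have "\<dots> = d * y - d"
    by (simp add: qvar_def [of "Suc 0"] dshift_def y_def algebra_simps sum_distrib_left)
  finally have "mps_trunc N d = mps_trunc N d * mps_trunc N y" by simp
  moreover have "mps_coeff (mps_trunc N y) {#} = 0"
    by (simp add: mps_coeff_trunc y_def mps_var_def mps_coeff_qvar)
  ultimately have "mps_trunc N d = 0" by (rule mps_eq_0_if_mult_small)
  then show "mps_trunc N u = mps_trunc N v" by (simp add: d_def)
qed

lemma gw_rep_unique:
  assumes "gw_rep c u F" "gw_rep c v G"
  shows "F = G"
proof -
  have "u = v"
    by (rule bser_equation_unique [of c]) (rule gw_repD [OF assms(1)] gw_repD [OF assms(2)], assumption?)+
  then show ?thesis
    using gw_repD(6) [OF assms(1)] gw_repD(6) [OF assms(2)] by (rule_tac mps_eqI_trunc [of 1]) (simp only:)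
qed

text \<open>
  The derivative falling on \<open>u\<close> contributes nothing: since \<open>\<partial>w\<^bsub>kl\<^esub>/\<partial>u = b\<^sub>k b\<^sub>l\<close>, it yields a multiple of
  \<open>(\<Sum> q\<^sub>k b\<^sub>k)\<^sup>2 = 0\<close>.
\<close>

lemma gw_rep_deriv:
  assumes F: "gw_rep c u F" and N: "N \<ge> 1" "m \<le> N"
  shows "mps_trunc N (mps_deriv m F) = mps_trunc N (\<Sum>k\<le>N. qvar k * W_coeff (bser c u) k m)"
proof -
  define b w where "b = bser c u" and "w = W_coeff b"
  have c: "c $ 0 = 1" "c \<in> carrier G_minus" using gw_repD [OF F] by auto
  have w_sym: "w k l = w l k" for k l
    unfolding w_def b_def using c by (intro W_coeff_commute) (auto simp: bser_nth_0 fps_neg_bser)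
  have w_deriv: "mps_deriv m (w k l) = b $ k * b $ l * mps_deriv m u" for k l
    unfolding w_def b_def using c by (intro mps_deriv_W_coeff_bser)
  define Q where "Q = (\<Sum>k\<le>N. qvar k * b $ k)"
  have Q: "mps_trunc N Q = 0" unfolding Q_def b_def by (rule gw_repD(5) [OF F N(1)])
  have "mps_trunc N (mps_deriv m F) = mps_trunc N (mps_deriv m
      (mps_const (1/2) * (\<Sum>k\<le>N. \<Sum>l\<le>N. qvar k * qvar l * w k l)))"
    using F N by (simp only: gw_rep_def mps_trunc_deriv w_def b_def)
  also have "mps_deriv m (mps_const (1/2) * (\<Sum>k\<le>N. \<Sum>l\<le>N. qvar k * qvar l * w k l))
    = mps_const (1/2) * (\<Sum>k\<le>N. \<Sum>l\<le>N. (if m = k then qvar l * w k l else 0)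
        + (if m = l then qvar k * w k l else 0)
        + (qvar k * b $ k) * (qvar l * b $ l) * mps_deriv m u)"
    unfolding mps_deriv_linear(6)
    unfolding mps_deriv_sum mps_deriv_mult mps_deriv_qvar w_deriv
    by (intro arg_cong2 [of _ _ _ _ "(*)"] sum.cong refl) (simp add: algebra_simps)
  also have "(\<Sum>k\<le>N. \<Sum>l\<le>N. (if m = k then qvar l * w k l else 0)
        + (if m = l then qvar k * w k l else 0)
        + (qvar k * b $ k) * (qvar l * b $ l) * mps_deriv m u)
    = (\<Sum>k\<le>N. \<Sum>l\<le>N. if m = k then qvar l * w k l else 0)
      + (\<Sum>k\<le>N. \<Sum>l\<le>N. if m = l then qvar k * w k l else 0) + Q * Q * mps_deriv m u"
    unfolding sum.distrib Q_def sum_product unfolding sum_distrib_right ..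
  also have "(\<Sum>k\<le>N. \<Sum>l\<le>N. if m = k then qvar l * w k l else 0) = (\<Sum>k\<le>N. qvar k * w k m)"
    using N by (subst sum.swap) (simp add: w_sym [of m])
  also have "(\<Sum>k\<le>N. \<Sum>l\<le>N. if m = l then qvar k * w k l else 0) = (\<Sum>k\<le>N. qvar k * w k m)"
    using N by simp
  finally show ?thesis
    using Q unfolding w_def b_def
    by (simp only: mps_trunc_mult mps_trunc_linear mps_half mult_zero_left mult_zero_right add_0_right)
qed

text \<open>In the formula for the first derivatives, the part differentiated through
  \<open>u\<close> is again a multiple of \<open>\<Sum> q_k b_k = 0\<close>.\<close>

lemma gw_rep_deriv2:
  assumes F: "gw_rep c u F"
  shows "mps_deriv n (mps_deriv m F) = W_coeff (bser c u) n m"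
proof (rule mps_eqI_trunc [of "Suc (max m n)"])
  fix N assume "N \<ge> Suc (max m n)"
  then have N: "N \<ge> 1" "m \<le> N" "n \<le> N" by auto
  define b w where "b = bser c u" and "w = W_coeff b"
  have c: "c $ 0 = 1" using gw_repD [OF F] by auto
  have w_deriv: "mps_deriv n (w k l) = b $ k * b $ l * mps_deriv n u" for k l
    unfolding w_def b_def using c by (intro mps_deriv_W_coeff_bser)
  define Q where "Q = (\<Sum>k\<le>N. qvar k * b $ k)"
  have Q: "mps_trunc N Q = 0" unfolding Q_def b_def by (rule gw_repD(5) [OF F N(1)])
  have "mps_trunc N (mps_deriv n (mps_deriv m F)) = mps_trunc N (mps_deriv n (\<Sum>k\<le>N. qvar k * w k m))"
    unfolding mps_trunc_deriv [OF N(3)] gw_rep_deriv [OF F N(1,2)] w_def b_def ..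
  also have "mps_deriv n (\<Sum>k\<le>N. qvar k * w k m)
    = (\<Sum>k\<le>N. (if n = k then w k m else 0) + qvar k * b $ k * (b $ m * mps_deriv n u))"
    unfolding mps_deriv_sum mps_deriv_mult mps_deriv_qvar w_deriv
    by (intro sum.cong refl) (simp add: mult.assoc)
  also have "\<dots> = w n m + Q * (b $ m * mps_deriv n u)"
    using N by (simp add: sum.distrib Q_def sum_distrib_right)
  finally show "mps_trunc N (mps_deriv n (mps_deriv m F)) = mps_trunc N (W_coeff (bser c u) n m)"
    using Q by (simp add: w_def b_def)
qed

text \<open>The second derivatives are \<open>w\<close>. (TRR) follows from
  \<open>w_k0 = b_(k+1)\<close> and the derivative of \<open>w\<close>, (DE) from the quadratic form
  of \<open>F\<close>, (SE) from the recursion for \<open>w\<close> and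
  \<open>\<Sum> q_k b_k = 0\<close>.\<close>

lemma gw_rep_imp_GW0:
  assumes F: "gw_rep c u F"
  shows "F \<in> GW0"
proof -
  define b w where "b = bser c u" and "w = W_coeff b"
  have c: "c $ 0 = 1" "c \<in> carrier G_minus" using gw_repD [OF F] by auto
  have b0: "b $ 0 = 1" using c by (simp add: b_def bser_nth_0)
  have w0: "w k 0 = b $ Suc k" for k
    unfolding w_def using b0 by (rule W_coeff_0)
  have w_sym: "w k l = w l k" for k l
    unfolding w_def b_def using c by (intro W_coeff_commute) (auto simp: bser_nth_0 fps_neg_bser)
  have w_deriv: "mps_deriv i (w k l) = b $ k * b $ l * mps_deriv i u" for i k l
    unfolding w_def b_def using c by (intro mps_deriv_W_coeff_bser)
  have dd: "mps_deriv n (mps_deriv m F) = w n m" for n m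
    using gw_rep_deriv2 [OF F] by (simp add: w_def b_def)
  have d: "mps_trunc N (mps_deriv m F) = mps_trunc N (\<Sum>k\<le>N. qvar k * w k m)"
    if "N \<ge> 1" "m \<le> N" for N m
    using gw_rep_deriv [OF F that] by (simp add: w_def b_def)
  have "topological_recursion F"
    unfolding topological_recursion_def
  proof (intro allI)
    fix k l m
    have "mps_deriv (k + 1) (mps_deriv l (mps_deriv m F)) = mps_deriv l (w (k + 1) m)"
      by (subst mps_deriv_commute) (simp only: dd)
    also have "\<dots> = w k 0 * mps_deriv l (w 0 m)"
      by (simp add: w_deriv w0 b0 mult.assoc)
    also have "mps_deriv l (w 0 m) = mps_deriv 0 (mps_deriv l (mps_deriv m F))"
      by (subst mps_deriv_commute) (simp only: dd)
    finally show "mps_deriv (k + 1) (mps_deriv l (mps_deriv m F)) =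
     mps_deriv k (mps_deriv 0 F) * mps_deriv 0 (mps_deriv l (mps_deriv m F))"
      unfolding dd [of k 0] .
  qed
  moreover have "dilaton_eq F"
    unfolding dilaton_eq_def
  proof (rule mps_eqI_trunc [of 1])
    fix N :: nat assume N: "N \<ge> 1"
    define A where "A = (\<Sum>k\<le>N. \<Sum>l\<le>N. qvar k * qvar l * w k l)"
    have "mps_trunc N (mps_sum (\<lambda>i. qvar i * mps_deriv i F))
      = (\<Sum>i\<le>N. mps_trunc N (qvar i) * mps_trunc N (mps_deriv i F))"
      using mps_trunc_infsum_qvar [OF N] by simp
    also have "\<dots> = (\<Sum>i\<le>N. mps_trunc N (qvar i) * mps_trunc N (\<Sum>k\<le>N. qvar k * w k i))"
      using N by (intro sum.cong refl) (simp only: d atMost_iff)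
    also have "\<dots> = mps_trunc N (\<Sum>i\<le>N. \<Sum>k\<le>N. qvar k * qvar i * w k i)"
      by (simp add: sum_distrib_left mult_ac)
    also have "(\<Sum>i\<le>N. \<Sum>k\<le>N. qvar k * qvar i * w k i) = A"
      unfolding A_def by (rule sum.swap)
    also have "mps_trunc N A = mps_trunc N F + mps_trunc N F"
      using F N by (simp add: gw_rep_def A_def w_def b_def mps_half_add del: mps_trunc_sum)
    also have "\<dots> = mps_trunc N (2 * F)" by (simp only: mult_2 mps_trunc_linear)
    finally show "mps_trunc N (mps_sum (\<lambda>i. qvar i * mps_deriv i F)) = mps_trunc N (2 * F)" .
  qed
  moreover have "string_eq F"
    unfolding string_eq_def
  proof (rule mps_eqI_trunc [of 1])
    fix N :: nat assume N: "N \<ge> 1"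
    \<comment> \<open>\<open>P\<close> is \<open>\<Sum> q_k b_k\<close> without its term
      \<open>q_0\<close>; \<open>A\<close> is the left side of (SE), and \<open>D\<close> its part
      with \<open>k > 0\<close>.\<close>
    define P where "P = (\<Sum>i<N. qvar (Suc i) * b $ Suc i)"
    define A where "A = (\<Sum>i<N. qvar (Suc i) * (\<Sum>k\<le>N. qvar k * w k i))"
    define D where "D = (\<Sum>i<N. \<Sum>j<N. qvar (Suc i) * qvar (Suc j) * w (Suc j) i)"
    have e: "qvar 0 + P = (\<Sum>k\<le>N. qvar k * b $ k)"
      by (simp add: sum.atMost_shift b0 P_def)
    have Q: "mps_trunc N (qvar 0 + P) = 0"
      unfolding e b_def by (rule gw_repD(5) [OF F N])
    have "A = (\<Sum>i<N. qvar (Suc i) * (qvar 0 * b $ Suc i + (\<Sum>j<N. qvar (Suc j) * w (Suc j) i)))"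
      unfolding A_def sum.atMost_shift by (simp add: w_sym [of 0] w0)
    also have "\<dots> = qvar 0 * P + D"
      by (simp add: P_def D_def sum.distrib sum_distrib_left distrib_left mult_ac)
    finally have A: "A = qvar 0 * P + D" .
    \<comment> \<open>Symmetrizing \<open>D\<close> produces
      \<open>w_(i,j+1) + w_(i+1,j) = b_(i+1) b_(j+1)\<close>, hence a square.\<close>
    have "D + D = (\<Sum>i<N. \<Sum>j<N. qvar (Suc i) * qvar (Suc j) * w (Suc j) i)
        + (\<Sum>i<N. \<Sum>j<N. qvar (Suc j) * qvar (Suc i) * w (Suc i) j)"
      unfolding D_def by (rule arg_cong2 [of _ _ _ _ "(+)"], rule refl, rule sum.swap)
    also have "\<dots> = (\<Sum>i<N. \<Sum>j<N. (qvar (Suc i) * b $ Suc i) * (qvar (Suc j) * b $ Suc j))"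
      unfolding sum.distrib [symmetric]
    proof (intro sum.cong refl)
      fix i j
      have "w i (Suc j) + w (Suc i) j = b $ Suc i * b $ Suc j"
        by (simp add: w_def W_coeff_Suc)
      then have "w (Suc j) i + w (Suc i) j = b $ Suc i * b $ Suc j"
        by (simp only: w_sym [of "Suc j" i])
      then have "qvar (Suc i) * qvar (Suc j) * (w (Suc j) i + w (Suc i) j)
        = qvar (Suc i) * qvar (Suc j) * (b $ Suc i * b $ Suc j)" by simp
      then show "qvar (Suc i) * qvar (Suc j) * w (Suc j) i + qvar (Suc j) * qvar (Suc i) * w (Suc i) j
        = (qvar (Suc i) * b $ Suc i) * (qvar (Suc j) * b $ Suc j)"
        by (simp only: distrib_left mult_ac)
    qed
    also have "\<dots> = P * P" by (simp only: P_def sum_product)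
    finally have D: "D + D = P * P" .
    \<comment> \<open>Completing the square: \<open>q_0 + P\<close> vanishes after truncation, which
      leaves \<open>-q_0^2\<close>.\<close>
    have "A + A = (qvar 0 + P) * (qvar 0 + P) - qvar 0 ^ 2"
    proof -
      have "A + A = qvar 0 * P + qvar 0 * P + (D + D)" by (simp only: A add_ac)
      then show ?thesis unfolding D by (simp add: algebra_simps power2_eq_square)
    qed
    then have "mps_trunc N (mps_const (1/2) * (A + A))
        = mps_trunc N (mps_const (1/2) * ((qvar 0 + P) * (qvar 0 + P) - qvar 0 ^ 2))"
      by simp
    also have "\<dots> = mps_trunc N (- mps_const (1/2) * qvar 0 ^ 2)"
      using Q by (simp only: right_diff_distrib mps_trunc_linear mps_trunc_mult) simp
    finally have A': "mps_trunc N A = mps_trunc N (- mps_const (1/2) * qvar 0 ^ 2)"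
      by (simp only: mps_half)
    have "mps_trunc N (mps_sum (\<lambda>i. qvar (i + 1) * mps_deriv i F))
      = (\<Sum>i<N. mps_trunc N (qvar (Suc i)) * mps_trunc N (mps_deriv i F))"
      using mps_trunc_infsum_qvar_Suc [OF N] by simp
    also have "\<dots> = mps_trunc N A"
      unfolding A_def mps_trunc_sum mps_trunc_mult
      using N by (intro sum.cong refl) (simp only: d [unfolded mps_trunc_sum mps_trunc_mult] lessThan_iff less_imp_le)
    finally show "mps_trunc N (mps_sum (\<lambda>i. qvar (i + 1) * mps_deriv i F))
      = mps_trunc N (- mps_const (1/2) * qvar 0 ^ 2)"
      using A' by (rule trans)
  qed
  ultimately show ?thesis by (simp add: GW0_def)
qed


section \<open>The action\<close>

lemma sum_atMost_if_le:
  fixes f :: "nat \<Rightarrow> 'a :: comm_monoid_add"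
  assumes "n \<le> N"
  shows "(\<Sum>k\<le>N. if k \<le> n then f k else 0) = (\<Sum>k\<le>n. f k)"
  by (rule sum.mono_neutral_cong_right) (use assms in auto)

lemma W_coeff_fps_lift: "W_coeff (fps_lift s) k l = mps_const (W_coeff s k l)"
  by (simp add: W_coeff_def mps_const_sum mps_const_simps mps_const_power)

lemma mps_trunc_q_plus_atMost:
  assumes "N \<ge> 1" "k \<le> N"
  shows "mps_trunc N (q_plus s k)
    = mps_trunc N (\<Sum>n\<le>N. (if k \<le> n then fps_lift s $ (n - k) else 0) * qvar n)"
proof -
  have "(\<Sum>n=k..N. mps_const (s $ (n - k)) * qvar n)
    = (\<Sum>n\<le>N. (if k \<le> n then fps_lift s $ (n - k) else 0) * qvar n)"
    by (rule sum.mono_neutral_cong_left) auto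
  then show ?thesis using mps_trunc_q_plus [OF assms] by (simp only:)
qed

text \<open>Substitution turns \<open>u\<close> into \<open>v\<close> and \<open>q\<close> into
  \<open>[s q]_+\<close>. Pairing with \<open>b\<close> moves \<open>s\<close> from \<open>q\<close>
  to \<open>b\<close>; the quadratic correction in \<open>quant\<close> is the second summand of
  \<open>W_coeff_mult\<close>.\<close>

lemma gw_rep_quant:
  assumes F: "gw_rep c u F" and S: "S \<in> carrier G_minus" "S $ 1 = 0"
  shows "\<exists>v. gw_rep (c * inverse S) v (quant S F)"
proof -
  define s where "s = inverse S"
  have s: "s \<in> carrier G_minus" unfolding s_def by (rule G_minus_inverse [OF S(1)])
  then have s0: "s $ 0 = 1" by (simp add: G_minus_iff)
  have S0: "S $ 0 = 1" using S by (simp add: G_minus_iff)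
  then have "S * s = 1" unfolding s_def by (intro inverse_mult_eq_1') simp
  then have "(S * s) $ 1 = 0" by simp
  then have s1: "s $ 1 = 0" using S S0 by (simp add: fps_mult_nth_1)
  note c = gw_repD(1-3) [OF F]
  define T where "T = (\<lambda>n. q_plus s n + dshift n)"
  have T: "linear_subst T" unfolding T_def using s0 s1 by (rule linear_subst_q_plus)
  have T_qvar: "mps_subst (qvar n) T = q_plus s n" for n
    by (simp add: mps_subst_qvar [OF T]) (simp add: T_def)
  define v where "v = mps_subst u T"
  define B where "B = bser c v"
  define L where "L = fps_lift s"
  \<comment> \<open>The matrix of \<open>[s q]_+\<close> in \<open>q\<close>; its transpose acts on
    coefficient sequences as multiplication by \<open>L\<close>.\<close>
  define a where "a k n = (if k \<le> n then L $ (n - k) else 0)" for k n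
  have BL: "bser (c * s) v = B * L" by (simp add: bser_mult B_def L_def)
  have B: "B $ 0 = 1" "fps_neg B * B = 1"
    unfolding B_def using c by (simp_all add: bser_nth_0 fps_neg_bser)
  have L: "L $ 0 = 1" "fps_neg L * L = 1"
    unfolding L_def using s s0 by (simp_all add: fps_neg_fps_lift_G_minus mps_const_simps)
  have q: "mps_trunc N (q_plus s k) = mps_trunc N (\<Sum>n\<le>N. a k n * qvar n)" if "N \<ge> 1" "k \<le> N" for N k
    using mps_trunc_q_plus_atMost [OF that] by (simp only: a_def L_def)
  have aB: "(\<Sum>k\<le>N. a k n * f k) = (\<Sum>k\<le>n. L $ (n - k) * f k)" if "n \<le> N" for n N f
  proof -
    have "(\<Sum>k\<le>N. a k n * f k) = (\<Sum>k\<le>N. if k \<le> n then L $ (n - k) * f k else 0)"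
      by (intro sum.cong refl) (simp add: a_def)
    then show ?thesis using sum_atMost_if_le [OF that] by (simp only:)
  qed
  have v_eq: "mps_trunc N (\<Sum>n\<le>N. qvar n * bser (c * s) v $ n) = 0" if N: "N \<ge> 1" for N
  proof -
    have "0 = mps_trunc N (mps_subst (mps_trunc N (\<Sum>k\<le>N. qvar k * bser c u $ k)) T)"
      by (simp only: gw_repD(5) [OF F N] mps_subst_0 mps_trunc_linear)
    also have "\<dots> = (\<Sum>k\<le>N. mps_trunc N (q_plus s k) * mps_trunc N (B $ k))"
      using T by (simp only: mps_trunc_subst mps_subst_sum mps_subst_mult T_qvar mps_subst_bser
          mps_trunc_sum mps_trunc_mult B_def v_def)
    also have "\<dots> = (\<Sum>k\<le>N. mps_trunc N (\<Sum>n\<le>N. a k n * qvar n) * mps_trunc N (B $ k))"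
      using N by (intro sum.cong refl) (simp only: q atMost_iff)
    also have "\<dots> = mps_trunc N (\<Sum>k\<le>N. \<Sum>n\<le>N. qvar n * (a k n * B $ k))"
      unfolding mps_trunc_sum mps_trunc_mult sum_distrib_right by (simp only: mult_ac)
    also have "(\<Sum>k\<le>N. \<Sum>n\<le>N. qvar n * (a k n * B $ k)) = (\<Sum>n\<le>N. qvar n * (\<Sum>k\<le>N. a k n * B $ k))"
      unfolding sum_distrib_left by (rule sum.swap)
    also have "\<dots> = (\<Sum>n\<le>N. qvar n * bser (c * s) v $ n)"
      unfolding BL by (intro sum.cong refl)
        (simp add: aB fps_mult_nth atLeast0AtMost mult.commute [of "B $ _"])
    finally show ?thesis ..
  qed
  have F_eq: "mps_trunc N (quant S F) = mps_trunc N (mps_const (1/2) *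
        (\<Sum>n\<le>N. \<Sum>m\<le>N. qvar n * qvar m * W_coeff (bser (c * s) v) n m))" if N: "N \<ge> 1" for N
  proof -
    \<comment> \<open>The matrix of the substituted quadratic form, which is the first summand in
      \<open>W_coeff_mult\<close>.\<close>
    define A where "A n m = (\<Sum>k\<le>N. \<Sum>l\<le>N. a k n * a l m * W_coeff B k l)" for n m
    have A: "A n m + mps_const (W_coeff s n m) = W_coeff (bser (c * s) v) n m"
      if nm: "n \<le> N" "m \<le> N" for n m
    proof -
      have "A n m = (\<Sum>k\<le>N. a k n * (\<Sum>l\<le>N. a l m * W_coeff B k l))"
        unfolding A_def by (simp only: sum_distrib_left mult.assoc)
      also have "\<dots> = (\<Sum>k\<le>n. \<Sum>l\<le>m. L $ (n - k) * L $ (m - l) * W_coeff B k l)"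
        by (simp only: aB nm) (simp only: sum_distrib_left mult.assoc)
      finally have "A n m + W_coeff L n m = W_coeff (B * L) n m"
        using W_coeff_mult [OF B L] by (simp only:)
      then show ?thesis by (simp only: L_def W_coeff_fps_lift BL)
    qed
    have "mps_trunc N (mps_subst F T) = mps_trunc N (mps_subst (mps_trunc N (mps_const (1/2) *
        (\<Sum>k\<le>N. \<Sum>l\<le>N. qvar k * qvar l * W_coeff (bser c u) k l))) T)"
      by (simp only: gw_repD(6) [OF F N, symmetric] mps_trunc_subst [OF T])
    also have "\<dots> = mps_const (1/2) * (\<Sum>k\<le>N. \<Sum>l\<le>N.
        mps_trunc N (q_plus s k) * mps_trunc N (q_plus s l) * mps_trunc N (W_coeff B k l))"
      using T by (simp only: mps_trunc_subst mps_subst_sum mps_subst_mult T_qvar mps_subst_W_coeff_bser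
          mps_trunc_sum mps_trunc_mult mps_subst_const mps_trunc_linear B_def v_def)
    also have "\<dots> = mps_const (1/2) * (\<Sum>k\<le>N. \<Sum>l\<le>N.
        mps_trunc N (\<Sum>n\<le>N. a k n * qvar n) * mps_trunc N (\<Sum>m\<le>N. a l m * qvar m)
          * mps_trunc N (W_coeff B k l))"
      using N by (intro arg_cong2 [of _ _ _ _ "(*)"] sum.cong refl) (simp_all only: q atMost_iff)
    also have "\<dots> = mps_trunc N (mps_const (1/2) * (\<Sum>k\<le>N. \<Sum>l\<le>N.
        (\<Sum>n\<le>N. \<Sum>m\<le>N. a k n * qvar n * (a l m * qvar m) * W_coeff B k l)))"
      unfolding sum_distrib_right [symmetric] sum_product [symmetric]
      by (simp only: mps_trunc_linear mps_trunc_mult mps_trunc_sum)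
    also have "(\<Sum>k\<le>N. \<Sum>l\<le>N. (\<Sum>n\<le>N. \<Sum>m\<le>N. a k n * qvar n * (a l m * qvar m) * W_coeff B k l))
      = (\<Sum>n\<le>N. \<Sum>m\<le>N. \<Sum>k\<le>N. \<Sum>l\<le>N. a k n * qvar n * (a l m * qvar m) * W_coeff B k l)"
      (is "(\<Sum>k\<in>?N. \<Sum>l\<in>?N. \<Sum>n\<in>?N. \<Sum>m\<in>?N. ?f k l n m) = _")
    proof -
      have "(\<Sum>k\<in>?N. \<Sum>l\<in>?N. \<Sum>n\<in>?N. \<Sum>m\<in>?N. ?f k l n m)
        = (\<Sum>k\<in>?N. \<Sum>n\<in>?N. \<Sum>m\<in>?N. \<Sum>l\<in>?N. ?f k l n m)"
        by (rule sum.cong [OF refl], subst sum.swap, rule sum.cong [OF refl], rule sum.swap)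
      also have "\<dots> = (\<Sum>n\<in>?N. \<Sum>m\<in>?N. \<Sum>k\<in>?N. \<Sum>l\<in>?N. ?f k l n m)"
        by (subst sum.swap, rule sum.cong [OF refl], rule sum.swap)
      finally show ?thesis .
    qed
    also have "\<dots> = (\<Sum>n\<le>N. \<Sum>m\<le>N. qvar n * qvar m * A n m)"
      unfolding A_def sum_distrib_left by (simp only: mult_ac)
    finally have 1: "mps_trunc N (mps_subst F T)
      = mps_trunc N (mps_const (1/2) * (\<Sum>n\<le>N. \<Sum>m\<le>N. qvar n * qvar m * A n m))" .
    have "mps_trunc N (mps_sum (\<lambda>(k, l). mps_const (W_series s $ k $ l) * qvar k * qvar l))
      = (\<Sum>p\<in>{..N} \<times> {..N}. mps_trunc N (case p of (k, l) \<Rightarrow> mps_const (W_series s $ k $ l) * qvar k * qvar l))"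
    proof (rule mps_trunc_infsum)
      fix p assume "p \<notin> {..N} \<times> {..N}"
      then have "fst p > N \<or> snd p > N" by (auto simp: mem_Times_iff)
      then show "mps_trunc N (case p of (k, l) \<Rightarrow> mps_const (W_series s $ k $ l) * qvar k * qvar l) = 0"
        using N by (auto simp: case_prod_beta mps_trunc_qvar_eq_0)
    qed simp
    also have "\<dots> = mps_trunc N (\<Sum>n\<le>N. \<Sum>m\<le>N. qvar n * qvar m * mps_const (W_coeff s n m))"
      unfolding W_series_nth [OF s] mps_trunc_sum sum.cartesian_product
      by (intro sum.cong refl) (auto simp: mult_ac)
    finally have 2: "mps_trunc N (mps_sum (\<lambda>(k, l). mps_const (W_series s $ k $ l) * qvar k * qvar l))
      = mps_trunc N (\<Sum>n\<le>N. \<Sum>m\<le>N. qvar n * qvar m * mps_const (W_coeff s n m))" .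
    have "mps_trunc N (quant S F) = mps_trunc N (mps_const (1/2) *
        ((\<Sum>n\<le>N. \<Sum>m\<le>N. qvar n * qvar m * A n m)
          + (\<Sum>n\<le>N. \<Sum>m\<le>N. qvar n * qvar m * mps_const (W_coeff s n m))))"
      unfolding quant_def s_def [symmetric] T_def [symmetric] distrib_left [of "mps_const (1/2)"]
      unfolding mps_trunc_linear(4) 1 mps_trunc_mult [of N _ "mps_sum _"] 2 mps_trunc_mult ..
    also have "(\<Sum>n\<le>N. \<Sum>m\<le>N. qvar n * qvar m * A n m)
          + (\<Sum>n\<le>N. \<Sum>m\<le>N. qvar n * qvar m * mps_const (W_coeff s n m))
      = (\<Sum>n\<le>N. \<Sum>m\<le>N. qvar n * qvar m * W_coeff (bser (c * s) v) n m)"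
      unfolding sum.distrib [symmetric] distrib_left [symmetric]
      by (intro sum.cong refl) (simp only: A atMost_iff)
    finally show ?thesis .
  qed
  have "gw_rep (c * s) v (quant S F)"
    unfolding gw_rep_def
  proof (intro conjI allI impI)
    show "c * s \<in> carrier G_minus" using c s by (intro G_minus_mult)
    show "(c * s) $ 1 = 0" using c s0 s1 by (simp add: fps_mult_nth_1)
    show "mps_coeff v {#} = 0" using gw_repD(4) [OF F] T by (simp add: v_def)
  qed (fact v_eq F_eq)+
  then show ?thesis unfolding s_def by blast
qed

section \<open>Every element of \<open>GW0\<close> is such a potential\<close>

text \<open>
  The series \<open>c\<close> is read off the origin: its coefficients are the values \<open>\<partial>\<^sub>0\<partial>\<^sub>j F(0)\<close>, shifted by one index.
\<close>

lemma GW0_imp_gw_rep: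
  assumes "F \<in> GW0"
  shows "\<exists>c u. gw_rep c u F"
proof -
  have DE: "mps_sum (\<lambda>i. qvar i * mps_deriv i F) = 2 * F"
    and SE: "mps_sum (\<lambda>i. qvar (i + 1) * mps_deriv i F) = - mps_const (1/2) * qvar 0 ^ 2"
    and TRR: "\<And>k l m. mps_deriv (k + 1) (mps_deriv l (mps_deriv m F)) =
      mps_deriv k (mps_deriv 0 F) * mps_deriv 0 (mps_deriv l (mps_deriv m F))"
    using assms by (auto simp: GW0_def dilaton_eq_def string_eq_def topological_recursion_def)
  define V where "V k l = mps_deriv k (mps_deriv l F)" for k l
  define u where "u = V 0 0"
  define c where "c = Abs_fps (\<lambda>n. case n of 0 \<Rightarrow> 1 | Suc j \<Rightarrow> mps_coeff (V 0 j) {#})"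
  define b where "b = bser c u"
  have V_sym: "V k l = V l k" for k l
    unfolding V_def by (rule mps_deriv_commute)
  have V_deriv: "mps_deriv i (V j k) = mps_deriv j (V i k)" for i j k
    unfolding V_def by (rule mps_deriv_commute)
  have V_Suc: "mps_deriv i (V (Suc k) l) = V k 0 * mps_deriv i (V 0 l)" for i k l
    using TRR [of k i l] by (simp only: Suc_eq_plus1 V_deriv [of i] V_def [symmetric])
  \<comment> \<open>(SE) differentiated by \<open>t_j\<close>. For \<open>j > 0\<close> the factor
    \<open>q_j\<close> in the sum is hit, for \<open>j = 0\<close> the right side is.\<close>
  have SE1: "mps_trunc N ((\<Sum>i<N. qvar (Suc i) * V j i)
      + (case j of 0 \<Rightarrow> qvar 0 | Suc j' \<Rightarrow> mps_deriv j' F)) = 0" if N: "N \<ge> 1" "j \<le> N" for N j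
  proof -
    have "mps_trunc N (\<Sum>i<N. qvar (Suc i) * mps_deriv i F)
      = mps_trunc N (- mps_const (1/2) * qvar 0 ^ 2)"
      using mps_trunc_infsum_qvar_Suc [OF N(1), of "\<lambda>i. mps_deriv i F"] by (simp only: SE)
    then have D: "mps_trunc N (mps_deriv j (\<Sum>i<N. qvar (Suc i) * mps_deriv i F))
      = mps_trunc N (mps_deriv j (- mps_const (1/2) * qvar 0 ^ 2))"
      by (simp only: mps_trunc_deriv [OF N(2)])
    have D1: "mps_deriv j (\<Sum>i<N. qvar (Suc i) * mps_deriv i F)
      = (\<Sum>i<N. if j = Suc i then mps_deriv i F else 0) + (\<Sum>i<N. qvar (Suc i) * V j i)"
      unfolding mps_deriv_sum mps_deriv_mult mps_deriv_qvar sum.distrib V_def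
      by (intro arg_cong2 [of _ _ _ _ "(+)"] sum.cong refl) auto
    have D2: "(\<Sum>i<N. if j = Suc i then mps_deriv i F else 0)
      = (case j of 0 \<Rightarrow> 0 | Suc j' \<Rightarrow> mps_deriv j' F)"
      using N by (cases j) auto
    have D3: "mps_deriv j (- mps_const (1/2) * qvar 0 ^ 2) = (if j = 0 then - qvar 0 else 0)"
    proof -
      have "mps_deriv j (- mps_const (1/2) * qvar 0 ^ 2)
        = - (mps_const (1/2) * (mps_deriv j (qvar 0) * qvar 0 + qvar 0 * mps_deriv j (qvar 0)))"
        by (simp only: mult_minus_left mps_deriv_linear power2_eq_square mps_deriv_mult
              mult_zero_left add_0)
      also have "\<dots> = - (mps_deriv j (qvar 0) * qvar 0)"
        by (simp only: mult.commute [of "qvar 0"] mps_half)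
      finally show ?thesis by simp
    qed
    show ?thesis
      using D unfolding D1 D2 D3 by (cases j) (simp_all add: add.commute del: mps_trunc_sum)
  qed
  have E0: "mps_trunc N ((\<Sum>i<N. qvar (Suc i) * V 0 i) + qvar 0) = 0" if "N \<ge> 1" for N
    using SE1 [OF that, of 0] by (simp only: nat.case le0)
  \<comment> \<open>At the origin \<open>q_0 = 0\<close> and \<open>q_1 = -1\<close>, so
    \<open>E0\<close> reads \<open>- u(0) = 0\<close>.\<close>
  have u0: "mps_coeff u {#} = 0"
    using arg_cong [OF E0 [of 1], of "\<lambda>F. mps_coeff F {#}"]
    by (simp add: mps_coeff_trunc mps_coeff_qvar u_def)
  \<comment> \<open>The \<open>t_0\<close>-derivative of \<open>E0\<close>: the string vector field
    sends \<open>u\<close> to -1.\<close>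
  have Eu: "mps_trunc N (\<Sum>i<N. qvar (Suc i) * mps_deriv i u) = - 1" if N: "N \<ge> 1" for N
  proof -
    have "mps_trunc N (mps_deriv 0 ((\<Sum>i<N. qvar (Suc i) * V 0 i) + qvar 0)) = 0"
      unfolding mps_trunc_deriv [OF le0] E0 [OF N] by simp
    also have "mps_deriv 0 ((\<Sum>i<N. qvar (Suc i) * V 0 i) + qvar 0)
      = (\<Sum>i<N. qvar (Suc i) * mps_deriv i u) + 1"
    proof -
      have "mps_deriv 0 (V 0 i) = mps_deriv i u" for i
        unfolding V_sym [of 0 i] V_deriv [of 0 i] u_def ..
      then show ?thesis by simp
    qed
    finally show ?thesis by (simp only: mps_trunc_linear eq_neg_iff_add_eq_0)
  qed
  \<comment> \<open>(TRR) is applied once in each index, with the symmetry of \<open>V\<close> in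
    between.\<close>
  have V_deriv_u: "mps_deriv i (V (Suc k) (Suc l)) = V k 0 * V l 0 * mps_deriv i u" for i k l
    by (simp add: V_Suc V_sym [of 0 "Suc l"] u_def mult.assoc)
  \<comment> \<open>(SE) is differentiated by \<open>t_(l+1)\<close> and \<open>t_(k+1)\<close>. The
    third derivatives are multiples of those of \<open>u\<close>, so \<open>Eu\<close> collapses the
    remaining sum to \<open>- V k 0 * V l 0\<close>.\<close>
  have V_rec: "V k (Suc l) + V (Suc k) l = V k 0 * V l 0" for k l
  proof (rule mps_eqI_trunc)
    fix N assume "N \<ge> Suc (max k l)"
    then have N: "N \<ge> 1" "Suc k \<le> N" "Suc l \<le> N" by auto
    have SE_l: "mps_trunc N ((\<Sum>i<N. qvar (Suc i) * V (Suc l) i) + mps_deriv l F) = 0"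
      using SE1 [OF N(1,3)] by (simp only: nat.case)
    have "0 = mps_trunc N (mps_deriv (Suc k)
        ((\<Sum>i<N. qvar (Suc i) * V (Suc l) i) + mps_deriv l F))"
      unfolding mps_trunc_deriv [OF N(2)] SE_l by simp
    also have "mps_deriv (Suc k) ((\<Sum>i<N. qvar (Suc i) * V (Suc l) i) + mps_deriv l F)
      = (\<Sum>i<N. if k = i then V (Suc l) i else 0)
        + (\<Sum>i<N. qvar (Suc i) * (V k 0 * V l 0 * mps_deriv i u)) + V (Suc k) l"
    proof -
      have "mps_deriv (Suc k) (V (Suc l) i) = V k 0 * V l 0 * mps_deriv i u" for i
        unfolding V_sym [of "Suc l"] V_deriv [of "Suc k"] V_deriv_u ..
      then show ?thesis
        unfolding mps_deriv_linear mps_deriv_sum mps_deriv_mult mps_deriv_qvar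
          V_def [symmetric, of "Suc k" l] sum.distrib
        by (intro arg_cong2 [of _ _ _ _ "(+)"] sum.cong refl) auto
    qed
    also have "(\<Sum>i<N. if k = i then V (Suc l) i else 0) = V k (Suc l)"
      using N by (simp add: V_sym [of k])
    also have "(\<Sum>i<N. qvar (Suc i) * (V k 0 * V l 0 * mps_deriv i u))
      = V k 0 * V l 0 * (\<Sum>i<N. qvar (Suc i) * mps_deriv i u)"
      unfolding sum_distrib_left by (simp only: mult_ac)
    finally have "0 = mps_trunc N (V k (Suc l)) - mps_trunc N (V k 0 * V l 0) + mps_trunc N (V (Suc k) l)"
      by (simp only: mps_trunc_linear mps_trunc_mult [of N "_ * _" "sum _ _"] Eu [OF N(1)]) simp
    then show "mps_trunc N (V k (Suc l) + V (Suc k) l) = mps_trunc N (V k 0 * V l 0)"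
      unfolding mps_trunc_linear by (metis add_diff_eq add.commute diff_add_cancel add_0)
  qed
  have c0: "c $ 0 = 1" by (simp add: c_def)
  have c1: "c $ 1 = 0" using u0 by (simp add: c_def u_def)
  have b0: "b $ 0 = 1" using c0 by (simp add: b_def bser_nth_0)
  \<comment> \<open>Both sides obey the same derivative rule, and \<open>c\<close> was chosen to
    match the values at the origin.\<close>
  have V_b: "V k 0 = b $ Suc k" for k
  proof (induction k)
    case 0
    then show ?case using c0 c1 by (simp add: b_def bser_nth_1 u_def)
  next
    case (Suc k)
    show ?case
    proof (rule mps_eqI_deriv)
      show "mps_deriv i (V (Suc k) 0) = mps_deriv i (b $ Suc (Suc k))" for i
        unfolding V_Suc Suc.IH b_def mps_deriv_bser_Suc u_def ..
      show "mps_coeff (V (Suc k) 0) {#} = mps_coeff (b $ Suc (Suc k)) {#}"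
        unfolding b_def mps_coeff_bser_empty [OF u0] by (simp add: c_def V_sym [of "Suc k"])
    qed
  qed
  have V_W: "V k l = W_coeff b k l" for k l
    using b0 V_b V_rec by (intro W_coeff_unique) (simp_all only:)
  \<comment> \<open>Symmetry of the second derivatives makes row 0 equal to column 0.\<close>
  have "fps_neg b * b = 1"
    unfolding fps_neg_mult_eq_1_iff [OF b0] by (simp only: V_W [symmetric] V_sym [of 0] V_b) simp
  \<comment> \<open>Evaluation at the origin is multiplicative and sends \<open>b\<close> to
    \<open>c\<close>, because \<open>u(0) = 0\<close>.\<close>
  have "fps_neg c * c = 1"
  proof (rule fps_ext)
    fix n
    have b_c: "mps_coeff (b $ k) {#} = c $ k" for k
      unfolding b_def by (rule mps_coeff_bser_empty [OF u0])
    have sgn: "mps_coeff ((- 1) ^ k) {#} = (- 1) ^ k" for k by simp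
    have "(fps_neg c * c) $ n = mps_coeff ((fps_neg b * b) $ n) {#}"
      by (simp only: fps_mult_nth fps_neg_nth mps_coeff_sum mps_coeff_mult_empty b_c sgn)
    also have "\<dots> = 1 $ n" unfolding \<open>fps_neg b * b = 1\<close> by simp
    finally show "(fps_neg c * c) $ n = 1 $ n" .
  qed
  have "gw_rep c u F"
    unfolding gw_rep_def
  proof (intro conjI allI impI)
    show "c \<in> carrier G_minus" using c0 \<open>fps_neg c * c = 1\<close> by (simp add: G_minus_iff_fps_neg)
  next
    fix N :: nat assume N: "N \<ge> 1"
    have "(\<Sum>k\<le>N. qvar k * bser c u $ k) = (\<Sum>i<N. qvar (Suc i) * V 0 i) + qvar 0"
      unfolding sum.atMost_shift b_def [symmetric] b0 V_sym [of 0] V_b by (simp only: mult_1_right add.commute)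
    then show "mps_trunc N (\<Sum>k\<le>N. qvar k * bser c u $ k) = 0" using E0 [OF N] by (simp only:)
  next
    fix N :: nat assume N: "N \<ge> 1"
    have DE': "mps_trunc N (\<Sum>i\<le>N. qvar i * mps_deriv i F) = mps_trunc N (F + F)"
      using mps_trunc_infsum_qvar [OF N, of "\<lambda>i. mps_deriv i F"] by (simp only: DE mult_2)
    \<comment> \<open>By (DE), \<open>F\<close> is homogeneous of degree 2 in \<open>q\<close>, so
      its first derivatives have degree 1. Feeding this back into (DE) expresses \<open>F\<close>
      through second derivatives.\<close>
    have dF: "mps_trunc N (mps_deriv k F) = mps_trunc N (\<Sum>i\<le>N. qvar i * V k i)" if "k \<le> N" for k
    proof -
      have "mps_trunc N (mps_deriv k (\<Sum>i\<le>N. qvar i * mps_deriv i F))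
        = mps_trunc N (mps_deriv k (F + F))"
        using DE' by (simp only: mps_trunc_deriv [OF that])
      also have "mps_deriv k (\<Sum>i\<le>N. qvar i * mps_deriv i F)
        = (\<Sum>i\<le>N. if k = i then mps_deriv i F else 0) + (\<Sum>i\<le>N. qvar i * V k i)"
        unfolding mps_deriv_sum mps_deriv_mult mps_deriv_qvar sum.distrib V_def
        by (intro arg_cong2 [of _ _ _ _ "(+)"] sum.cong refl) auto
      also have "(\<Sum>i\<le>N. if k = i then mps_deriv i F else 0) = mps_deriv k F"
        using that by simp
      finally show ?thesis by (simp only: mps_trunc_linear mps_deriv_linear add_left_cancel)
    qed
    have "mps_trunc N (F + F) = (\<Sum>k\<le>N. mps_trunc N (qvar k) * mps_trunc N (mps_deriv k F))"
      unfolding DE' [symmetric] by simp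
    also have "\<dots> = (\<Sum>k\<le>N. mps_trunc N (qvar k) * mps_trunc N (\<Sum>i\<le>N. qvar i * V k i))"
      by (intro sum.cong refl) (simp only: dF atMost_iff)
    also have "\<dots> = mps_trunc N (\<Sum>k\<le>N. \<Sum>l\<le>N. qvar k * qvar l * W_coeff (bser c u) k l)"
      unfolding mps_trunc_mult [symmetric] mps_trunc_sum [symmetric] sum_distrib_left
        b_def [symmetric] V_W by (simp only: mult.assoc)
    finally have "mps_const (1/2) * mps_trunc N (F + F) = mps_trunc N (mps_const (1/2) *
        (\<Sum>k\<le>N. \<Sum>l\<le>N. qvar k * qvar l * W_coeff (bser c u) k l))"
      by (simp only: mps_trunc_mult mps_trunc_linear)
    then show "mps_trunc N F = mps_trunc N (mps_const (1/2) *
        (\<Sum>k\<le>N. \<Sum>l\<le>N. qvar k * qvar l * W_coeff (bser c u) k l))"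
      by (simp only: mps_trunc_linear mps_half)
  qed (fact c1 u0)+
  then show ?thesis by blast
qed

section \<open>Group structure, action laws and transitivity\<close>

lemma group_G_minus: "group G_minus"
proof (rule groupI)
  show "\<exists>T\<in>carrier G_minus. T \<otimes>\<^bsub>G_minus\<^esub> S = \<one>\<^bsub>G_minus\<^esub>" if "S \<in> carrier G_minus" for S
  proof
    show "inverse S \<otimes>\<^bsub>G_minus\<^esub> S = \<one>\<^bsub>G_minus\<^esub>"
      using that by (simp add: G_minus_def inverse_mult_eq_1)
  qed (rule G_minus_inverse [OF that])
  show "S \<otimes>\<^bsub>G_minus\<^esub> T \<in> carrier G_minus"
    if "S \<in> carrier G_minus" "T \<in> carrier G_minus" for S T
    using G_minus_mult [OF that] by (simp add: G_minus_def)
  show "\<one>\<^bsub>G_minus\<^esub> \<in> carrier G_minus"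
    by (simp add: G_minus_def)
qed (simp_all add: G_minus_def mult.assoc)

definition reduced :: "complex fps \<Rightarrow> complex fps" where
  "reduced S = fps_exp (- (S $ 1)) * S"

lemma G_act_reduced: "G_act S F = quant (reduced S) F"
  by (simp add: G_act_def reduced_def)

text \<open>The \<open>z^(-1)\<close> coefficient is additive on series with leading term 1.\<close>

lemma reduced_mult:
  assumes "S \<in> carrier G_minus" "T \<in> carrier G_minus"
  shows "reduced (S * T) = reduced S * reduced T"
proof -
  have "(S * T) $ 1 = S $ 1 + T $ 1"
    using assms by (simp add: G_minus_iff fps_mult_nth_1 add.commute)
  then have "fps_exp (- ((S * T) $ 1)) = fps_exp (- (S $ 1)) * fps_exp (- (T $ 1))"
    by (simp flip: fps_exp_add_mult)
  then show ?thesis by (simp only: reduced_def mult_ac)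
qed

lemma gw_rep_G_act:
  assumes "gw_rep c u F" "S \<in> carrier G_minus"
  shows "\<exists>v. gw_rep (c * inverse (reduced S)) v (G_act S F)"
  unfolding G_act_reduced reduced_def using assms G_minus_decomp(2,3) by (intro gw_rep_quant)

lemma G_act_GW0:
  assumes "S \<in> carrier G_minus" "F \<in> GW0"
  shows "G_act S F \<in> GW0"
  using GW0_imp_gw_rep [OF assms(2)] gw_rep_G_act [OF _ assms(1)] gw_rep_imp_GW0 by blast

text \<open>Both sides are represented by the same series because multiplication is commutative, and
  that series determines the potential. No composite of substitutions has to be computed.\<close>

lemma G_act_mult:
  assumes S: "S \<in> carrier G_minus" and T: "T \<in> carrier G_minus" and F: "F \<in> GW0"
  shows "G_act (S * T) F = G_act S (G_act T F)"
proof -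
  obtain c u where c: "gw_rep c u F" using GW0_imp_gw_rep [OF F] by blast
  obtain v where v: "gw_rep (c * inverse (reduced T)) v (G_act T F)"
    using gw_rep_G_act [OF c T] by blast
  obtain w where w: "gw_rep (c * inverse (reduced T) * inverse (reduced S)) w (G_act S (G_act T F))"
    using gw_rep_G_act [OF v S] by blast
  obtain x where x: "gw_rep (c * inverse (reduced (S * T))) x (G_act (S * T) F)"
    using gw_rep_G_act [OF c G_minus_mult [OF S T]] by blast
  have "c * inverse (reduced (S * T)) = c * inverse (reduced T) * inverse (reduced S)"
    by (simp only: reduced_mult [OF S T] fps_inverse_mult mult_ac)
  then show ?thesis using gw_rep_unique w x by metis
qed

lemma G_act_one:
  assumes "F \<in> GW0"
  shows "G_act 1 F = F"
proof -
  obtain c u where c: "gw_rep c u F" using GW0_imp_gw_rep [OF assms] by blast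
  have 1: "1 \<in> carrier G_minus" by (simp add: G_minus_def)
  have "reduced 1 = 1" by (simp add: reduced_def)
  then obtain v where "gw_rep c v (G_act 1 F)" using gw_rep_G_act [OF c 1] by auto
  then show ?thesis using gw_rep_unique c by blast
qed

theorem corollary4p2:
  shows "transitive_action G_minus GW0 (\<lambda>S. \<lambda>F\<in>GW0. G_act S F)"
proof -
  \<comment> \<open>Elements of \<open>BijGroup\<close> are extensional functions, hence the
    restriction to \<open>GW0\<close>.\<close>
  let ?\<phi> = "\<lambda>S. \<lambda>F\<in>GW0. G_act S F"
  have inv: "inverse S \<in> carrier G_minus" "inverse S * S = 1" "S * inverse S = 1"
    if "S \<in> carrier G_minus" for S
    using that G_minus_inverse [OF that]
    by (auto simp: G_minus_iff intro!: inverse_mult_eq_1 inverse_mult_eq_1')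
  have bij: "?\<phi> S \<in> Bij GW0" if S: "S \<in> carrier G_minus" for S
  proof -
    have "bij_betw (?\<phi> S) GW0 GW0"
    proof (rule bij_betw_byWitness)
      show "\<forall>F\<in>GW0. G_act (inverse S) (?\<phi> S F) = F"
        using inv [OF S] S by (simp add: G_act_mult [symmetric] G_act_one)
      show "\<forall>F\<in>GW0. ?\<phi> S (G_act (inverse S) F) = F"
        using inv [OF S] S by (simp add: G_act_GW0 G_act_mult [symmetric] G_act_one)
    qed (use inv [OF S] S in \<open>auto simp: G_act_GW0\<close>)
    then show ?thesis by (simp add: Bij_def)
  qed
  have "?\<phi> (S * T) = compose GW0 (?\<phi> S) (?\<phi> T)"
    if "S \<in> carrier G_minus" "T \<in> carrier G_minus" for S T
    using that by (auto simp: compose_def G_act_mult G_act_GW0)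
  then have "?\<phi> \<in> hom G_minus (BijGroup GW0)"
    using bij by (auto simp: hom_def BijGroup_def G_minus_def)
  then have hom: "group_hom G_minus (BijGroup GW0) ?\<phi>"
    using group_G_minus group_BijGroup by (simp add: group_hom_def group_hom_axioms_def)
  show ?thesis
  proof (intro transitive_action.intro group_action.intro transitive_action_axioms.intro hom)
    fix F F' assume F: "F \<in> GW0" and F': "F' \<in> GW0"
    obtain c u where c: "gw_rep c u F" using GW0_imp_gw_rep [OF F] by blast
    obtain c' u' where c': "gw_rep c' u' F'" using GW0_imp_gw_rep [OF F'] by blast
    \<comment> \<open>The solution of \<open>c * inverse S = c'\<close>. Neither \<open>c\<close>
      nor \<open>c'\<close> has a \<open>z^(-1)\<close> term, so \<open>S\<close> is its own
      reduction.\<close>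
    define S where "S = c * inverse c'"
    have S: "S \<in> carrier G_minus"
      unfolding S_def using gw_repD(1) [OF c] gw_repD(1) [OF c'] by (intro G_minus_mult inv)
    have "inverse c' * c' = 1" using inv gw_repD(1) [OF c'] by blast
    then have "(inverse c' * c') $ 1 = 0" by simp
    then have "S $ 1 = 0" using gw_repD [OF c] gw_repD [OF c']
      by (simp add: S_def fps_mult_nth_1)
    then have "reduced S = S" by (simp add: reduced_def)
    then obtain v where v: "gw_rep (c * inverse S) v (G_act S F)"
      using gw_rep_G_act [OF c S] by auto
    have "c * inverse S = c * (inverse c * inverse (inverse c'))"
      by (simp only: S_def fps_inverse_mult)
    also have "\<dots> = c'"
      using gw_repD [OF c] gw_repD [OF c'] inv(3) [of c] by (simp add: mult.assoc [symmetric])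
    finally have "G_act S F = F'" using v c' gw_rep_unique by metis
    then show "\<exists>S\<in>carrier G_minus. ?\<phi> S F = F'" using S F by auto
  qed
qed


end
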